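(* Let $K$ be a non-archimedean local field with absolute value $|\cdot|$, ring of integers $O_K$, uniformizing parameter $\pi$, and residue field $O_K/\pi O_K$ of order $q$, and let $n\in\mathbb{Z}$. If $n\ge0$, then the $\delta$-equilibrium measure of $\pi^nO_K$ is the additive Haar measure $\lambda_n$, and it has energy \[ V_\delta(\pi^nO_K)=-n\log|\pi|-\frac{\log|\pi|}{q-1}. \] If $n<0$, then the $\delta$-equilibrium measure of $\pi^nO_K$ is given by \[ \mu_n=c_0\lambda_0+c_{-1}\nu_{-1}+\cdots+c_n\nu_n, \] where the constants $c_0,c_{-1},\ldots,c_n\ge0$ sum to $1$ and are explicitly given by a linear system, and the $\delta$-Robin constant is \[ V_\delta(\pi^nO_K)=-\frac{q+q^{2n}}{q^2-1}\log|\pi|. \]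
   Context: Here $O_K=\{x\in K:|x|\le1\}$. The measure $\lambda_k$ denotes the unit (probability) Haar measure of $\pi^kO_K$ as an additive group, and $\nu_k$ denotes the unit Haar measure of $\pi^kO_K^\times$, i.e. the unique Borel probability measure on $\pi^kO_K^\times$ invariant under multiplication by elements of $O_K^\times$. On $\mathbb{P}^1(K)$ the spherical metric is $\delta(x,y)=\frac{|x_0y_1-y_0x_1|}{\max\{|x_0|,|x_1|\}\max\{|y_0|,|y_1|\}}$ for $x=(x_0:x_1)$, $y=(y_0:y_1)$. Regarding $K$ as a subset of $\mathbb{P}^1(K)$ via $x\mapsto(x:1)$, this means $\delta(x,y)=\frac{|x-y|}{\max\{1,|x|\}\max\{1,|y|\}}$ for $x,y\in K$. For a Borel probability measure $\nu$ on $\mathbb{P}^1(K)$, the $\delta$-energy is $I_\delta(\nu)=\iint-\log\delta(x,y)\,d\nu(x)\,d\nu(y)$. For a compact set $E$, the $\delta$-Robin constant is $V_\delta(E)=\inf_\nu I_\delta(\nu)$, the infimum being over Borel probability measures $\nu$ supported on $E$. The $\delta$-equilibrium measure of $E$ is the unique Borel probability measure $\mu$ supported on $E$ with $I_\delta(\mu)=V_\delta(E)$. *)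

theory Defs
  imports "HOL-Probability.Probability"
begin

section \<open>Non-archimedean local fields\<close>

text \<open>
  A field with a nontrivial ultrametric absolute value \<open>absval\<close> whose induced metric
  topology is locally compact. The absolute value need not be normalised, and the
  characteristic is arbitrary. Nonnegativity and definiteness of \<open>absval\<close> follow from
  \<open>dist x y = absval (x - y)\<close>. (The class \<open>real_normed_field\<close>, to which \<open>norm\<close> is tied,
  cannot be used: it forces the absolute value to be archimedean.)
\<close>

class nonarch_local_field = field + metric_space +
  fixes absval :: "'a \<Rightarrow> real"
  assumes nonarch_dist: "dist x y = absval (x - y)"
    and nonarch_absval_mult: "absval (x * y) = absval x * absval y"
    and nonarch_absval_add: "absval (x + y) \<le> max (absval x) (absval y)"
    and nonarch_absval_nontrivial: "\<exists>x. x \<noteq> 0 \<and> absval x \<noteq> 1"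
    and nonarch_locally_compact: "\<exists>U C. open U \<and> x \<in> U \<and> U \<subseteq> C \<and> compact C"
begin

lemma nonarch_absval_nonneg: "absval x \<ge> 0"
  using nonarch_dist[of x 0] zero_le_dist[of x 0] by simp

lemma nonarch_absval_eq_0_iff: "absval x = 0 \<longleftrightarrow> x = 0"
  using nonarch_dist[of x 0] dist_eq_0_iff[of x 0] by simp

lemma nonarch_absval_minus: "absval (- x) = absval x"
  using nonarch_dist[of 0 x] nonarch_dist[of x 0] dist_commute[of x 0] by simp

lemma nonarch_absval_diff: "absval (x - y) \<le> max (absval x) (absval y)"
  using nonarch_absval_add[of x "- y"] by (simp add: nonarch_absval_minus)

end

definition integer_ring :: "'a::nonarch_local_field set"
  where "integer_ring = {x. absval x \<le> 1}"

definition unit_group :: "'a::nonarch_local_field set"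
  where "unit_group = {x \<in> integer_ring. \<exists>y \<in> integer_ring. x * y = 1}"

text \<open>A uniformizing parameter is a generator of the maximal ideal of the ring of integers.\<close>

definition uniformizer :: "'a::nonarch_local_field \<Rightarrow> bool"
  where "uniformizer \<pi> \<longleftrightarrow> {x. absval x < 1} = (*) \<pi> ` integer_ring"

definition residue_classes :: "'a::nonarch_local_field \<Rightarrow> 'a set set"
  where "residue_classes \<pi> = integer_ring //
    {(x, y). x \<in> integer_ring \<and> y \<in> integer_ring \<and> x - y \<in> (*) \<pi> ` integer_ring}"

definition frac_ideal :: "'a::nonarch_local_field \<Rightarrow> int \<Rightarrow> 'a set"
  where "frac_ideal \<pi> k = (*) (\<pi> powi k) ` integer_ring"

definition unit_sphere :: "'a::nonarch_local_field \<Rightarrow> int \<Rightarrow> 'a set"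
  where "unit_sphere \<pi> k = (*) (\<pi> powi k) ` unit_group"

section \<open>Measures\<close>

text \<open>
  Borel probability measures supported on a set \<open>E\<close>, as measures on the ambient space.
  For closed \<open>E\<close> in a second countable space this says that the support of \<open>\<mu>\<close> is
  contained in \<open>E\<close>.
\<close>

definition borel_prob_on :: "'a::topological_space set \<Rightarrow> 'a measure \<Rightarrow> bool"
  where "borel_prob_on E \<mu> \<longleftrightarrow> sets \<mu> = sets borel \<and> prob_space \<mu> \<and> (AE x in \<mu>. x \<in> E)"

definition add_haar :: "'a::nonarch_local_field \<Rightarrow> int \<Rightarrow> 'a measure"
  where "add_haar \<pi> k = (THE \<mu>. borel_prob_on (frac_ideal \<pi> k) \<mu> \<and>
    (\<forall>a \<in> frac_ideal \<pi> k. distr \<mu> borel ((+) a) = \<mu>))"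

definition mult_haar :: "'a::nonarch_local_field \<Rightarrow> int \<Rightarrow> 'a measure"
  where "mult_haar \<pi> k = (THE \<mu>. borel_prob_on (unit_sphere \<pi> k) \<mu> \<and>
    (\<forall>u \<in> unit_group. distr \<mu> borel ((*) u) = \<mu>))"

text \<open>The linear combination \<open>\<Sum>k\<in>I. c k \<cdot> M k\<close> of Borel measures, for finite \<open>I\<close> and
  nonnegative coefficients.\<close>

definition lincomb_measure ::
    "'i set \<Rightarrow> ('i \<Rightarrow> real) \<Rightarrow> ('i \<Rightarrow> 'a::topological_space measure) \<Rightarrow> 'a measure"
  where "lincomb_measure I c M =
    measure_of UNIV (sets borel) (\<lambda>A. \<Sum>k\<in>I. ennreal (c k) * emeasure (M k) A)"

section \<open>The projective line and the spherical metric\<close>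

definition proj_rel :: "'a::field \<times> 'a \<Rightarrow> 'a \<times> 'a \<Rightarrow> bool"
  where "proj_rel x y \<longleftrightarrow> x \<noteq> (0, 0) \<and> (\<exists>c. c \<noteq> 0 \<and> y = (c * fst x, c * snd x))"

lemma part_equivp_proj_rel: "part_equivp (proj_rel :: 'a::field \<times> 'a \<Rightarrow> _)"
proof (rule part_equivpI)
  show "\<exists>x. proj_rel x (x :: 'a \<times> 'a)"
    by (rule exI[of _ "(0, 1)"]) (auto simp: proj_rel_def intro!: exI[of _ 1])
  show "symp (proj_rel :: 'a \<times> 'a \<Rightarrow> _)"
  proof (rule sympI)
    fix x y :: "'a \<times> 'a" assume "proj_rel x y"
    then obtain c where "x \<noteq> (0, 0)" "c \<noteq> 0" "y = (c * fst x, c * snd x)"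
      by (auto simp: proj_rel_def)
    then show "proj_rel y x"
      by (cases x) (auto simp: proj_rel_def intro!: exI[of _ "inverse c"])
  qed
  show "transp (proj_rel :: 'a \<times> 'a \<Rightarrow> _)"
  proof (rule transpI)
    fix x y z :: "'a \<times> 'a" assume "proj_rel x y" "proj_rel y z"
    then obtain c d where "x \<noteq> (0, 0)" "c \<noteq> 0" "y = (c * fst x, c * snd x)"
      "d \<noteq> 0" "z = (d * fst y, d * snd y)"
      unfolding proj_rel_def by blast
    then show "proj_rel x z"
      by (auto simp: proj_rel_def intro!: exI[of _ "d * c"])
  qed
qed

quotient_type (overloaded) 'a proj_line = "'a::field \<times> 'a" / partial: proj_rel
  by (rule part_equivp_proj_rel)

lift_definition affine_point :: "'a::field \<Rightarrow> 'a proj_line" is "\<lambda>x. (x, 1)"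
  by (auto simp: proj_rel_def intro!: exI[of _ 1])

definition pair_norm :: "'a::nonarch_local_field \<times> 'a \<Rightarrow> real"
  where "pair_norm x = max (absval (fst x)) (absval (snd x))"

definition pair_wedge :: "'a::nonarch_local_field \<times> 'a \<Rightarrow> 'a \<times> 'a \<Rightarrow> 'a"
  where "pair_wedge x y = fst x * snd y - fst y * snd x"

lemma pair_norm_scale: "pair_norm (c * fst x, c * snd x) = absval c * pair_norm x"
  by (simp add: pair_norm_def nonarch_absval_mult nonarch_absval_nonneg max_mult_distrib_left)

lemma pair_wedge_scale:
  "pair_wedge (c * fst x, c * snd x) (d * fst y, d * snd y) = c * d * pair_wedge x y"
  by (simp add: pair_wedge_def algebra_simps)

lemma pair_norm_pos:
  assumes "x \<noteq> (0, 0)" shows "pair_norm x > 0"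
  using assms nonarch_absval_nonneg[of "fst x"] nonarch_absval_nonneg[of "snd x"]
    nonarch_absval_eq_0_iff[of "fst x"] nonarch_absval_eq_0_iff[of "snd x"]
  by (cases x) (auto simp: pair_norm_def less_max_iff_disj less_le)

lemma pair_wedge_ultra:
  "absval (pair_wedge x z) * pair_norm y
    \<le> max (absval (pair_wedge x y) * pair_norm z) (absval (pair_wedge y z) * pair_norm x)"
proof -
  have mult_le: "absval (a * b) \<le> absval b * m" if "absval a \<le> m" for a b :: 'a and m
    using mult_right_mono[OF that nonarch_absval_nonneg[of b]]
    by (simp add: nonarch_absval_mult mult.commute[of m])
  have key: "absval w * absval (pair_wedge x z)
      \<le> max (absval (pair_wedge x y) * pair_norm z) (absval (pair_wedge y z) * pair_norm x)"
    if "w * pair_wedge x z = u * pair_wedge y z + v * pair_wedge x y"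
      "absval u \<le> pair_norm x" "absval v \<le> pair_norm z" for u v w
  proof -
    have "absval w * absval (pair_wedge x z) = absval (u * pair_wedge y z + v * pair_wedge x y)"
      by (simp add: that(1)[symmetric] nonarch_absval_mult)
    also have "\<dots> \<le> max (absval (u * pair_wedge y z)) (absval (v * pair_wedge x y))"
      by (rule nonarch_absval_add)
    also have "\<dots> \<le> max (absval (pair_wedge y z) * pair_norm x) (absval (pair_wedge x y) * pair_norm z)"
      by (intro max.mono mult_le that)
    finally show ?thesis by (simp add: max.commute)
  qed
  have "absval (fst y) * absval (pair_wedge x z)
      \<le> max (absval (pair_wedge x y) * pair_norm z) (absval (pair_wedge y z) * pair_norm x)"
    by (rule key[of _ "fst x" "fst z"]) (simp_all add: pair_wedge_def pair_norm_def algebra_simps)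
  moreover have "absval (snd y) * absval (pair_wedge x z)
      \<le> max (absval (pair_wedge x y) * pair_norm z) (absval (pair_wedge y z) * pair_norm x)"
    by (rule key[of _ "snd x" "snd z"]) (simp_all add: pair_wedge_def pair_norm_def algebra_simps)
  ultimately show ?thesis
    unfolding pair_norm_def[of y] mult.commute[of "absval (pair_wedge x z)"]
    by (cases "absval (fst y) \<le> absval (snd y)") (simp_all only: max_def if_True if_False)
qed

lift_definition sphere_dist :: "'a::nonarch_local_field proj_line \<Rightarrow> 'a proj_line \<Rightarrow> real"
  is "\<lambda>x y. absval (fst x * snd y - fst y * snd x) /
        (max (absval (fst x)) (absval (snd x)) * max (absval (fst y)) (absval (snd y)))"
proof -
  fix x x' y y' :: "'a \<times> 'a"
  assume "proj_rel x x'" "proj_rel y y'"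
  then obtain c d where cd: "c \<noteq> 0" "d \<noteq> 0"
    and eq: "x' = (c * fst x, c * snd x)" "y' = (d * fst y, d * snd y)"
    by (auto simp: proj_rel_def)
  have "absval (pair_wedge x y) / (pair_norm x * pair_norm y)
      = absval (pair_wedge x' y') / (pair_norm x' * pair_norm y')"
    using cd by (simp add: eq pair_norm_scale pair_wedge_scale nonarch_absval_mult nonarch_absval_eq_0_iff)
  then show "?thesis x x' y y'"
    by (simp add: pair_norm_def pair_wedge_def)
qed

lemma proj_line_cases:
  obtains a where "a \<noteq> (0, 0)" "x = abs_proj_line a"
proof -
  have "proj_rel (rep_proj_line x) (rep_proj_line x)" "x = abs_proj_line (rep_proj_line x)"
    using Quotient_proj_line by (metis Quotient_rel_rep, metis Quotient_abs_rep)
  then show ?thesis using that unfolding proj_rel_def by blast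
qed

lemma proj_rel_refl: "a \<noteq> (0, 0) \<Longrightarrow> proj_rel a a"
  by (auto simp: proj_rel_def intro!: exI[of _ 1])

lemma sphere_dist_abs:
  assumes "a \<noteq> (0, 0)" "b \<noteq> (0, 0)"
  shows "sphere_dist (abs_proj_line a) (abs_proj_line b)
    = absval (pair_wedge a b) / (pair_norm a * pair_norm b)"
  using sphere_dist.abs_eq[OF proj_rel_refl[OF assms(1)] proj_rel_refl[OF assms(2)]]
  by (simp add: pair_norm_def pair_wedge_def)

lemma sphere_dist_nonneg: "sphere_dist x y \<ge> 0"
proof -
  obtain a where a: "a \<noteq> (0, 0)" "x = abs_proj_line a" by (rule proj_line_cases)
  obtain b where b: "b \<noteq> (0, 0)" "y = abs_proj_line b" by (rule proj_line_cases)
  show ?thesis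
    using a b pair_norm_pos[OF a(1)] pair_norm_pos[OF b(1)]
    by (simp add: sphere_dist_abs nonarch_absval_nonneg)
qed

lemma sphere_dist_commute: "sphere_dist x y = sphere_dist y x"
proof -
  obtain a where a: "a \<noteq> (0, 0)" "x = abs_proj_line a" by (rule proj_line_cases)
  obtain b where b: "b \<noteq> (0, 0)" "y = abs_proj_line b" by (rule proj_line_cases)
  have "pair_wedge a b = - pair_wedge b a" by (simp add: pair_wedge_def)
  then have "absval (pair_wedge a b) = absval (pair_wedge b a)"
    by (metis nonarch_absval_minus)
  then show ?thesis
    using a b by (simp add: sphere_dist_abs mult.commute)
qed

lemma pair_wedge_eq_0_iff:
  assumes "a \<noteq> (0, 0)" "b \<noteq> (0, 0)"
  shows "pair_wedge a b = 0 \<longleftrightarrow> proj_rel a b"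
proof
  assume "proj_rel a b"
  then show "pair_wedge a b = 0" by (auto simp: proj_rel_def pair_wedge_def)
next
  assume eq: "pair_wedge a b = 0"
  show "proj_rel a b"
  proof (cases "fst a = 0")
    case True
    with assms eq have "snd a \<noteq> 0" "fst b = 0" "snd b \<noteq> 0"
      by (cases a; cases b; auto simp: pair_wedge_def)+
    with True assms show ?thesis
      by (cases b) (auto simp: proj_rel_def intro!: exI[of _ "snd b / snd a"])
  next
    case False
    have "fst b \<noteq> 0"
      using False assms eq by (cases b) (auto simp: pair_wedge_def)
    with False assms eq show ?thesis
      by (cases b) (auto simp: proj_rel_def pair_wedge_def field_simps
        intro!: exI[of _ "fst b / fst a"])
  qed
qed

lemma sphere_dist_eq_0_iff: "sphere_dist x y = 0 \<longleftrightarrow> x = y"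
proof -
  obtain a where a: "a \<noteq> (0, 0)" "x = abs_proj_line a" by (rule proj_line_cases)
  obtain b where b: "b \<noteq> (0, 0)" "y = abs_proj_line b" by (rule proj_line_cases)
  have "sphere_dist x y = 0 \<longleftrightarrow> proj_rel a b"
    using a b pair_norm_pos[OF a(1)] pair_norm_pos[OF b(1)]
    by (simp add: sphere_dist_abs nonarch_absval_eq_0_iff pair_wedge_eq_0_iff)
  also have "\<dots> \<longleftrightarrow> x = y"
    using Quotient_rel[OF Quotient_proj_line, of a b] a b by (auto simp: proj_rel_refl)
  finally show ?thesis .
qed

lemma sphere_dist_ultra: "sphere_dist x z \<le> max (sphere_dist x y) (sphere_dist y z)"
proof -
  obtain a where a: "a \<noteq> (0, 0)" "x = abs_proj_line a" by (rule proj_line_cases)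
  obtain b where b: "b \<noteq> (0, 0)" "y = abs_proj_line b" by (rule proj_line_cases)
  obtain c where c: "c \<noteq> (0, 0)" "z = abs_proj_line c" by (rule proj_line_cases)
  define A B C where "A = pair_norm a" "B = pair_norm b" "C = pair_norm c"
  have pos: "A > 0" "B > 0" "C > 0"
    using a b c by (simp_all add: A_B_C_def pair_norm_pos)
  have "absval (pair_wedge a c) * B
      \<le> max (absval (pair_wedge a b) * C) (absval (pair_wedge b c) * A)"
    unfolding A_B_C_def by (rule pair_wedge_ultra)
  then show ?thesis
    using a b c pos
    by (auto simp: sphere_dist_abs A_B_C_def[symmetric] le_max_iff_disj field_simps)
qed

lemma sphere_dist_le_1: "sphere_dist x y \<le> 1"
proof -
  obtain a where a: "a \<noteq> (0, 0)" "x = abs_proj_line a" by (rule proj_line_cases)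
  obtain b where b: "b \<noteq> (0, 0)" "y = abs_proj_line b" by (rule proj_line_cases)
  have "absval (pair_wedge a b) \<le> max (absval (fst a * snd b)) (absval (fst b * snd a))"
    unfolding pair_wedge_def by (rule nonarch_absval_diff)
  also have "\<dots> \<le> pair_norm a * pair_norm b"
    by (auto simp: nonarch_absval_mult pair_norm_def mult.commute[of "absval (fst b)"]
        intro!: mult_mono simp: nonarch_absval_nonneg le_max_iff_disj)
  finally show ?thesis
    using a b pair_norm_pos[OF a(1)] pair_norm_pos[OF b(1)] by (simp add: sphere_dist_abs)
qed

lemma sphere_dist_affine_point:
  "sphere_dist (affine_point x) (affine_point y) =
    absval (x - y) / (max 1 (absval x) * max 1 (absval y))"
proof -
  have "absval (1 :: 'a) * absval (1 :: 'a) = absval (1 :: 'a)"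
    by (simp flip: nonarch_absval_mult)
  then have "absval (1 :: 'a) = 1"
    using nonarch_absval_eq_0_iff[of "1 :: 'a"] by simp
  then show ?thesis
    by (simp add: affine_point.abs_eq sphere_dist_abs pair_norm_def pair_wedge_def max.commute)
qed

instantiation proj_line :: (nonarch_local_field) metric_space
begin

definition dist_proj_line :: "'a proj_line \<Rightarrow> 'a proj_line \<Rightarrow> real"
  where "dist_proj_line = sphere_dist"

definition uniformity_proj_line :: "('a proj_line \<times> 'a proj_line) filter"
  where "uniformity_proj_line = (INF e\<in>{0<..}. principal {(x, y). dist x y < e})"

definition open_proj_line :: "'a proj_line set \<Rightarrow> bool"
  where "open_proj_line U \<longleftrightarrow> (\<forall>x\<in>U. \<forall>\<^sub>F (x', y) in uniformity. x' = x \<longrightarrow> y \<in> U)"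

instance
proof
  fix x y z :: "'a proj_line"
  show "dist x y = 0 \<longleftrightarrow> x = y"
    unfolding dist_proj_line_def sphere_dist_eq_0_iff ..
  have "dist x y \<le> max (sphere_dist x z) (sphere_dist z y)"
    unfolding dist_proj_line_def by (rule sphere_dist_ultra)
  also have "\<dots> \<le> dist x z + dist y z"
    using sphere_dist_nonneg[of x z] sphere_dist_nonneg[of z y]
    by (simp add: dist_proj_line_def sphere_dist_commute[of z y])
  finally show "dist x y \<le> dist x z + dist y z" .
qed (simp_all add: uniformity_proj_line_def open_proj_line_def)

end

text \<open>
  The kernel \<open>- log \<delta>(x, y)\<close>, with value \<open>\<infinity>\<close> on the diagonal (recall that \<open>ln 0 = 0\<close> in HOL).
  Elsewhere \<open>0 < \<delta>(x, y) \<le> 1\<close>, so the kernel is nonnegative and \<^const>\<open>ennreal\<close> loses nothing.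
\<close>

definition neg_log_dist :: "'a::nonarch_local_field proj_line \<Rightarrow> 'a proj_line \<Rightarrow> ennreal"
  where "neg_log_dist x y = (if x = y then \<infinity> else ennreal (- ln (sphere_dist x y)))"

definition energy :: "'a::nonarch_local_field proj_line measure \<Rightarrow> ennreal"
  where "energy \<nu> = (\<integral>\<^sup>+ y. (\<integral>\<^sup>+ x. neg_log_dist x y \<partial>\<nu>) \<partial>\<nu>)"

definition robin_const :: "'a::nonarch_local_field proj_line set \<Rightarrow> ennreal"
  where "robin_const E = (INF \<nu> \<in> {\<nu>. borel_prob_on E \<nu>}. energy \<nu>)"

definition equilibrium_measure ::
    "'a::nonarch_local_field proj_line set \<Rightarrow> 'a proj_line measure \<Rightarrow> bool"
  where "equilibrium_measure E \<mu> \<longleftrightarrow> borel_prob_on E \<mu> \<and> energy \<mu> = robin_const E \<and>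
    (\<forall>\<nu>. borel_prob_on E \<nu> \<and> energy \<nu> = robin_const E \<longrightarrow> \<nu> = \<mu>)"

definition to_proj :: "'a::nonarch_local_field measure \<Rightarrow> 'a proj_line measure"
  where "to_proj \<mu> = distr \<mu> borel affine_point"

section \<open>The linear system for the coefficients\<close>

text \<open>
  The component measure with index \<open>0\<close> is \<open>\<lambda>\<^sub>0\<close>, the one with index \<open>k < 0\<close> is \<open>\<nu>\<^sub>k\<close>.
\<close>

definition component :: "'a::nonarch_local_field \<Rightarrow> int \<Rightarrow> 'a measure"
  where "component \<pi> k = (if k = 0 then add_haar \<pi> 0 else mult_haar \<pi> k)"

text \<open>
  For \<open>i, j \<le> 0\<close>, \<open>energy_matrix l q i j\<close> with \<open>l = - log \<bar>\<pi>\<bar>\<close> is the mutual energy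
  \<open>\<integral>\<integral> - log \<delta>(x, y) d\<mu>\<^sub>i(x) d\<mu>\<^sub>j(y)\<close> of the components \<open>\<mu>\<^sub>i\<close> and \<open>\<mu>\<^sub>j\<close>. Indeed, if
  \<open>i \<noteq> j\<close> then \<open>\<delta>(x, y) = \<bar>\<pi>\<bar> ^ min (-i) (-j)\<close> almost surely. If \<open>i = j < 0\<close> then
  \<open>\<delta>(\<pi>\<^sup>iu, \<pi>\<^sup>iv) = \<bar>\<pi>\<bar>\<^sup>-\<^sup>i \<bar>u - v\<bar>\<close>, and \<open>\<bar>u - v\<bar> \<le> \<bar>\<pi>\<bar>\<^sup>k\<close> has probability
  \<open>q\<^sup>1\<^sup>-\<^sup>k / (q - 1)\<close> for independent Haar distributed units \<open>u, v\<close> and \<open>k \<ge> 1\<close>;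
  sum over \<open>k\<close>. Similarly with \<open>q\<^sup>-\<^sup>k\<close> for \<open>i = j = 0\<close>.
\<close>

definition energy_matrix :: "real \<Rightarrow> nat \<Rightarrow> int \<Rightarrow> int \<Rightarrow> real"
  where "energy_matrix l q i j = l *
    (if i \<noteq> j then real_of_int (min (- i) (- j))
     else if i = 0 then 1 / (real q - 1)
     else real_of_int (- i) + real q / (real q - 1)\<^sup>2)"

text \<open>
  The linear system, in the unknowns \<open>c k\<close> (\<open>n \<le> k \<le> 0\<close>) and \<open>v\<close>, says that the total mass is
  \<open>1\<close> and that the potential of \<open>\<Sum>k. c k \<cdot> \<mu>\<^sub>k\<close> takes the same value \<open>v\<close> on all the
  pieces \<open>O\<^sub>K\<close>, \<open>\<pi>\<^sup>-\<^sup>1O\<^sub>K\<^sup>\<times>\<close>, and so on up to \<open>\<pi>\<^sup>nO\<^sub>K\<^sup>\<times>\<close> of \<open>\<pi>\<^sup>nO\<^sub>K\<close>.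
\<close>

definition equilibrium_system :: "real \<Rightarrow> nat \<Rightarrow> int \<Rightarrow> (int \<Rightarrow> real) \<Rightarrow> real \<Rightarrow> bool"
  where "equilibrium_system l q n c v \<longleftrightarrow>
    (\<forall>i\<in>{n..0}. (\<Sum>j\<in>{n..0}. energy_matrix l q i j * c j) = v) \<and> (\<Sum>j\<in>{n..0}. c j) = 1"

end

(*
  Since -log delta(x, y) is l = -log |pi| times the number of k >= 1 with delta(x, y) <= |pi|^k, the
  energy of nu is l times the sum over k of the sums of nu(B)^2 over the balls B of radius |pi|^k.
  If the potential of mu is a constant V on E, the mixed terms of sum (nu(B) - mu(B))^2 equal V
  for every nu supported on E, so the energy of nu is V + l * sum (nu(B) - mu(B))^2.  Thus mu is
  a minimiser, and the only one because a measure is determined by its ball masses.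

  The potentials of the Haar measures are geometric series, as their ball masses depend only on
  the radius; on the spheres they are the entries of the energy matrix, which has the form
  min(i, j) + diagonal and is therefore positive definite.
*)

theory Submission
  imports Defs
begin

section \<open>Measures on compact ultrametric spaces\<close>

text \<open>\<open>add_haar\<close> and \<open>mult_haar\<close> are defined by \<open>THE\<close>,
  so existence and uniqueness of both Haar measures must be supplied before any energy can be
  computed. Both live on compact ultrametric sets and give balls of equal radius equal mass, and
  such a measure is determined by counting balls. Existence rests on one probabilistic construction:
  on \<open>integer_ring\<close> the measure is the law of a random series in \<pi> with independent
  uniform digits; scaling gives the other ideals, and conditioning an ideal on its sphere gives the
  multiplicative measures. Ultrametricity is isolated in a class because it serves twice, for the
  field (Haar measures) and for the projective line (energies). Energies may be infinite, so the sum
  of squares is reached by adding terms on both sides in \<open>ennreal\<close>, never by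
  subtracting. For \<open>n < 0\<close>, positive definiteness is used for uniqueness of the
  solution of the system; its nonnegativity and value come from a closed form, found through the
  tail sums \<open>c i + ... + c N\<close>. The constant is then visible in row 0, where all
  \<open>min\<close> entries vanish: it is \<open>l * c 0 / (q - 1)\<close>.\<close>

class ultrametric_space = metric_space +
  assumes ultrametric: "dist x z \<le> max (dist x y) (dist y z)"

instance nonarch_local_field \<subseteq> ultrametric_space
proof
  fix x y z :: 'a
  show "dist x z \<le> max (dist x y) (dist y z)"
    using nonarch_absval_add[of "x - y" "y - z"] by (simp add: nonarch_dist)
qed

instance proj_line :: (nonarch_local_field) ultrametric_space
  by standard (simp add: dist_proj_line_def sphere_dist_ultra)

section \<open>Balls of one radius as a finite Borel partition\<close>

lemma cball_eq_cball:
  fixes x :: "'a::ultrametric_space"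
  assumes "y \<in> cball x s"
  shows "cball y s = cball x s"
proof -
  have "dist x z \<le> s \<longleftrightarrow> dist y z \<le> s" for z
    using assms ultrametric[of x z y] ultrametric[of y z x] by (auto simp: dist_commute)
  then show ?thesis by auto
qed

lemma finite_cballs:
  fixes E :: "'a::ultrametric_space set"
  assumes "compact E" "s > 0"
  shows "finite ((\<lambda>x. cball x s) ` E)"
proof -
  obtain T where T: "T \<subseteq> E" "finite T" "E \<subseteq> (\<Union>x\<in>T. ball x s)"
  proof (rule compactE_image[OF assms(1), of E "\<lambda>x. ball x s"])
    show "E \<subseteq> (\<Union>x\<in>E. ball x s)" using assms(2) by force
  qed auto
  have "(\<lambda>x. cball x s) ` E \<subseteq> (\<lambda>x. cball x s) ` T"
  proof (rule image_subsetI)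
    fix x assume "x \<in> E"
    then obtain t where "t \<in> T" "x \<in> ball t s" using T(3) by blast
    then show "cball x s \<in> (\<lambda>x. cball x s) ` T" using cball_eq_cball[of x t s] by auto
  qed
  then show ?thesis using T(2) finite_surj by blast
qed

lemma borel_prob_onD:
  assumes "borel_prob_on E M"
  shows "sets M = sets borel" "prob_space M" "AE x in M. x \<in> E"
    and "finite_measure M" "space M = UNIV"
  using assms sets_eq_imp_space_eq[of M borel] prob_space.finite_measure
  by (auto simp: borel_prob_on_def)

text \<open>Balls of radius \<open>s\<close> around nearby points coincide, so the function is
  locally constant, hence continuous, whatever \<open>F\<close> is. With \<open>F\<close> a measure
  this gives measurability of potentials.\<close>

lemma cball_locally_constant_borel:
  fixes F :: "'a::ultrametric_space set \<Rightarrow> 'b::topological_space"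
  assumes "s > 0"
  shows "(\<lambda>x. F (cball x s)) \<in> borel_measurable borel"
proof (rule borel_measurable_continuous_onI)
  have "\<forall>\<^sub>F z in at x. F (cball z s) = F (cball x s)" for x
    using eventually_at_ball'[OF assms, of x UNIV]
    by (rule eventually_mono) (use cball_eq_cball[of _ x s] in auto)
  then show "continuous_on UNIV (\<lambda>x. F (cball x s))"
    unfolding continuous_on_def by (intro ballI tendsto_eventually)
qed

text \<open>In an ultrametric space the balls of a fixed radius form a partition.\<close>

lemma nn_integral_cball:
  fixes E :: "'a::ultrametric_space set"
  assumes "compact E" "s > 0" "borel_prob_on E M"
  shows "(\<integral>\<^sup>+ x. F (cball x s) \<partial>M) = (\<Sum>B\<in>(\<lambda>x. cball x s) ` E. F B * emeasure M B)"
proof -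
  let ?P = "(\<lambda>x. cball x s) ` E"
  note M = borel_prob_onD[OF assms(3)]
  have fin: "finite ?P" using finite_cballs assms by blast
  have sets: "B \<in> sets M" if "B \<in> ?P" for B using that unfolding M(1) by fastforce
  have "(\<integral>\<^sup>+ x. F (cball x s) \<partial>M) = (\<integral>\<^sup>+ x. (\<Sum>B\<in>?P. F B * indicator B x) \<partial>M)"
  proof (rule nn_integral_cong_AE)
    have "F (cball x s) = (\<Sum>B\<in>?P. F B * indicator B x)" if x: "x \<in> E" for x
    proof -
      have "(\<Sum>B\<in>?P. F B * indicator B x) = (\<Sum>B\<in>?P. if B = cball x s then F B else 0)"
      proof (rule sum.cong[OF refl])
        fix B assume "B \<in> ?P"
        then obtain y where "y \<in> E" "B = cball y s" by auto
        then show "F B * indicator B x = (if B = cball x s then F B else 0)"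
          using cball_eq_cball[of x y s] assms(2) by (auto split: split_indicator)
      qed
      also have "\<dots> = F (cball x s)" using fin x by simp
      finally show ?thesis by simp
    qed
    then show "AE x in M. F (cball x s) = (\<Sum>B\<in>?P. F B * indicator B x)"
      by (rule eventually_mono[OF M(3)])
  qed
  also have "\<dots> = (\<Sum>B\<in>?P. \<integral>\<^sup>+ x. F B * indicator B x \<partial>M)"
  proof (rule nn_integral_sum)
    fix B assume "B \<in> ?P"
    then have "B \<in> sets M" by (rule sets)
    then show "(\<lambda>x. F B * indicator B x) \<in> borel_measurable M"
      by (rule borel_measurable_times_ennreal[OF borel_measurable_const borel_measurable_indicator])
  qed
  also have "\<dots> = (\<Sum>B\<in>?P. F B * emeasure M B)"
    by (intro sum.cong refl nn_integral_cmult_indicator sets)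
  finally show ?thesis .
qed

lemma sum_measure_cballs:
  fixes E :: "'a::ultrametric_space set"
  assumes "compact E" "s > 0" "borel_prob_on E M"
  shows "(\<Sum>B\<in>(\<lambda>x. cball x s) ` E. measure M B) = 1"
proof -
  interpret prob_space M by (rule borel_prob_onD(2)[OF assms(3)])
  have "1 = (\<Sum>B\<in>(\<lambda>x. cball x s) ` E. emeasure M B)"
    using nn_integral_cball[OF assms, of "\<lambda>_. 1"] by (simp add: emeasure_space_1)
  then show ?thesis
    by (simp add: emeasure_eq_measure)
qed

text \<open>A closed subset of \<open>E\<close> is the decreasing limit of finite unions of small balls.\<close>

lemma borel_prob_on_eqI:
  fixes E :: "'a::ultrametric_space set"
  assumes E: "compact E" and M: "borel_prob_on E M" and N: "borel_prob_on E N"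
    and eq: "\<And>e. e > 0 \<Longrightarrow> \<exists>s. 0 < s \<and> s < e \<and> (\<forall>x\<in>E. measure M (cball x s) = measure N (cball x s))"
  shows "M = N"
proof -
  note MD = borel_prob_onD[OF M] and ND = borel_prob_onD[OF N]
  interpret M: prob_space M by (rule MD)
  interpret N: prob_space N by (rule ND)
  let ?good = "\<lambda>k s. 0 < s \<and> s < 1 / Suc k \<and> (\<forall>x\<in>E. measure M (cball x s) = measure N (cball x s))"
  \<comment> \<open>Decreasing radii make the unions of balls below a decreasing sequence, as
    continuity from above requires.\<close>
  have "\<exists>s. \<forall>k. ?good k (s k) \<and> s (Suc k) \<le> s k"
  proof (rule dependent_nat_choice)
    show "\<exists>x. ?good 0 x" using eq[of 1] by simp
    fix x :: real and k assume "?good k x"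
    then show "\<exists>y. ?good (Suc k) y \<and> y \<le> x"
      using eq[of "min x (1 / Suc (Suc k))"] by fastforce
  qed
  then obtain s where s: "\<And>k. 0 < s k" "\<And>k. s k < 1 / Suc k"
    "\<And>k x. x \<in> E \<Longrightarrow> measure M (cball x (s k)) = measure N (cball x (s k))"
    and dec: "\<And>k. s (Suc k) \<le> s k"
    by blast
  have closed_eq: "emeasure M F = emeasure N F" if F: "closed F" for F
  proof -
    define P where "P k = (\<lambda>x. cball x (s k)) ` (E \<inter> F)" for k
    have fin: "finite (P k)" for k
      unfolding P_def using finite_cballs[OF E s(1)] by (rule rev_finite_subset) auto
    have UP: "emeasure M (\<Union>(P k)) = emeasure N (\<Union>(P k))" for k
    proof -
      have dis: "pairwise disjnt (P k)"
      proof (rule pairwiseI)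
        fix A B assume "A \<in> P k" "B \<in> P k" "A \<noteq> B"
        then obtain x y where "A = cball x (s k)" "B = cball y (s k)" by (auto simp: P_def)
        with \<open>A \<noteq> B\<close> show "disjnt A B"
          using cball_eq_cball[of _ x "s k"] cball_eq_cball[of _ y "s k"]
          unfolding disjnt_iff by metis
      qed
      have sum: "measure L (\<Union>(P k)) = (\<Sum>B\<in>P k. measure L B)"
        if L: "finite_measure L" "sets L = sets borel" for L
      proof (rule measure_Union'[OF fin _ dis])
        fix B assume "B \<in> P k"
        then have "B \<in> sets borel" unfolding P_def by fastforce
        then show "B \<in> fmeasurable L"
          by (simp add: finite_measure.fmeasurable_eq_sets[OF L(1)] L(2))
      qed
      have "(\<Sum>B\<in>P k. measure M B) = (\<Sum>B\<in>P k. measure N B)"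
        by (rule sum.cong) (auto simp: P_def s(3))
      then show ?thesis
        unfolding M.emeasure_eq_measure N.emeasure_eq_measure
        by (simp only: sum[OF MD(4,1)] sum[OF ND(4,1)])
    qed
    \<comment> \<open>A point that is within \<open>s k\<close> of \<open>E \<inter> F\<close> for
      every \<open>k\<close> lies in the closure of that set, which is closed.\<close>
    have Int: "(\<Inter>k. \<Union>(P k)) = F \<inter> E"
    proof (intro equalityI subsetI)
      fix z assume z: "z \<in> (\<Inter>k. \<Union>(P k))"
      have "z \<in> closure (F \<inter> E)"
      proof (rule closure_approachable[THEN iffD2], intro allI impI)
        fix e :: real assume "e > 0"
        then obtain k where k: "1 / Suc k < e" using nat_approx_posE by blast
        obtain x where "x \<in> E \<inter> F" "dist x z \<le> s k" using z by (auto simp: P_def)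
        then show "\<exists>y\<in>F \<inter> E. dist y z < e" using s(2)[of k] k by (intro bexI[of _ x]) auto
      qed
      then show "z \<in> F \<inter> E"
        using closed_Int[OF F compact_imp_closed[OF E]] by simp
    next
      fix z assume "z \<in> F \<inter> E"
      then have "z \<in> \<Union>(P k)" for k
        using s(1)[of k] by (auto simp: P_def intro!: bexI[of _ z])
      then show "z \<in> (\<Inter>k. \<Union>(P k))" by blast
    qed
    have lim: "emeasure L (F \<inter> E) = (INF k. emeasure L (\<Union>(P k)))"
      if L: "finite_measure L" "sets L = sets borel" for L
    proof -
      interpret L: finite_measure L by (rule L)
      have "(INF k. emeasure L (\<Union>(P k))) = emeasure L (\<Inter>k. \<Union>(P k))"
      proof (rule INF_emeasure_decseq)
        show "range (\<lambda>k. \<Union>(P k)) \<subseteq> sets L"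
          using fin by (auto simp: L P_def intro!: sets.finite_Union)
        have "\<Union>(P (Suc k)) \<subseteq> \<Union>(P k)" for k
          unfolding P_def using order_trans[OF _ dec[of k]] by auto
        then show "decseq (\<lambda>k. \<Union>(P k))" by (rule decseq_SucI)
      qed simp
      then show ?thesis by (simp add: Int)
    qed
    have "emeasure M (F \<inter> E) = emeasure N (F \<inter> E)"
      by (simp only: lim[OF MD(4,1)] lim[OF ND(4,1)] UP)
    \<comment> \<open>Both measures are carried by \<open>E\<close>, so the result for
      \<open>F \<inter> E\<close> extends to \<open>F\<close>; closed sets are an
      intersection-stable generator.\<close>
    moreover have "emeasure L (F \<inter> E) = emeasure L F"
      if L: "sets L = sets borel" "AE x in L. x \<in> E" for L
    proof (rule emeasure_eq_AE)
      show "AE x in L. x \<in> F \<inter> E \<longleftrightarrow> x \<in> F" using L(2) by (rule eventually_mono) simp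
    qed (use F compact_imp_closed[OF E] in \<open>simp_all add: L(1)\<close>)
    ultimately show ?thesis using MD ND by metis
  qed
  show ?thesis
  proof (rule measure_eqI_generator_eq[where E = "Collect closed" and \<Omega> = UNIV and A = "\<lambda>_. UNIV"])
    show "sets M = sigma_sets UNIV (Collect closed)" "sets N = sigma_sets UNIV (Collect closed)"
      using MD ND by (simp_all add: borel_eq_closed)
  qed (use closed_eq in \<open>auto simp: Int_stable_def\<close>)
qed

section \<open>Measures giving equal mass to balls of equal radius\<close>

text \<open>A metric substitute for invariance under a group. It treats additive Haar measure on a
  ball and multiplicative Haar measure on a sphere alike.\<close>

definition homogeneous_measure :: "'a::ultrametric_space set \<Rightarrow> 'a measure \<Rightarrow> bool"
  where "homogeneous_measure E M \<longleftrightarrow> borel_prob_on E M \<and>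
    (\<forall>s>0. \<forall>x\<in>E. \<forall>y\<in>E. measure M (cball x s) = measure M (cball y s))"

text \<open>The balls partition \<open>E\<close> up to a null set into parts of equal mass. The
  resulting value depends on \<open>E\<close> and \<open>s\<close> alone, which is why two such
  measures coincide.\<close>

lemma measure_cball_homogeneous:
  assumes "compact E" "homogeneous_measure E M" "s > 0" "x \<in> E"
  shows "measure M (cball x s) = 1 / card ((\<lambda>x. cball x s) ` E)"
proof -
  let ?P = "(\<lambda>x. cball x s) ` E"
  have "1 = (\<Sum>B\<in>?P. measure M B)"
    using assms sum_measure_cballs[of E s M] by (simp add: homogeneous_measure_def)
  also have "\<dots> = (\<Sum>B\<in>?P. measure M (cball x s))"
  proof (rule sum.cong[OF refl])
    fix B assume "B \<in> ?P"
    then obtain y where "y \<in> E" "B = cball y s" by blast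
    with assms(2-4) show "measure M B = measure M (cball x s)"
      unfolding homogeneous_measure_def by blast
  qed
  finally have "card ?P * measure M (cball x s) = 1" by simp
  then show ?thesis by (metis mult_zero_left nonzero_mult_div_cancel_left zero_neq_one)
qed

lemma homogeneous_measure_unique:
  assumes "compact E" "homogeneous_measure E M" "homogeneous_measure E N"
  shows "M = N"
proof (rule borel_prob_on_eqI)
  fix e :: real assume "e > 0"
  then show "\<exists>s. 0 < s \<and> s < e \<and> (\<forall>x\<in>E. measure M (cball x s) = measure N (cball x s))"
    using assms by (intro exI[of _ "e / 2"]) (simp add: measure_cball_homogeneous)
qed (use assms in \<open>auto simp: homogeneous_measure_def\<close>)

lemma similarity_borel:
  fixes T :: "'a::metric_space \<Rightarrow> 'b::metric_space"
  assumes T: "\<And>x y. dist (T x) (T y) = c * dist x y" and c: "c > 0"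
  shows "continuous_on UNIV T" "T \<in> borel_measurable borel"
proof -
  show "continuous_on UNIV T"
    unfolding continuous_on_iff T
  proof (intro ballI allI impI)
    fix x e assume "0 < (e::real)"
    then show "\<exists>d>0. \<forall>x'\<in>UNIV. dist x' x < d \<longrightarrow> c * dist x' x < e"
      using c by (intro exI[of _ "e / c"]) (simp add: field_simps)
  qed
  then show "T \<in> borel_measurable borel" by (rule borel_measurable_continuous_onI)
qed

lemma measure_distr_cball_similarity:
  fixes T :: "'a::metric_space \<Rightarrow> 'b::metric_space"
  assumes T: "\<And>x y. dist (T x) (T y) = c * dist x y" and c: "c > 0" and M: "sets M = sets borel"
  shows "measure (distr M borel T) (cball (T x) s) = measure M (cball x (s / c))"
proof -
  have "T -` cball (T x) s = cball x (s / c)"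
    using c by (auto simp: T field_simps)
  moreover have "T \<in> borel_measurable M"
    using similarity_borel(2)[OF T c] M by (simp cong: measurable_cong_sets)
  ultimately show ?thesis
    using sets_eq_imp_space_eq[OF M] by (simp add: measure_distr)
qed

lemma borel_prob_on_distr:
  assumes M: "borel_prob_on E M" and T: "T \<in> borel_measurable borel" and "T ` E \<in> sets borel"
  shows "borel_prob_on (T ` E) (distr M borel T)"
proof -
  note D = borel_prob_onD[OF M]
  have T': "T \<in> borel_measurable M" using T D(1) by (simp cong: measurable_cong_sets)
  have "AE x in M. T x \<in> T ` E" using D(3) by (rule eventually_mono) simp
  then have "AE y in distr M borel T. y \<in> T ` E"
    using assms(3) by (subst AE_distr_iff[OF T']) auto
  then show ?thesis
    using prob_space.prob_space_distr[OF D(2) T'] by (simp add: borel_prob_on_def)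
qed

lemma homogeneous_measure_similarity:
  fixes T :: "'a::ultrametric_space \<Rightarrow> 'b::ultrametric_space"
  assumes M: "homogeneous_measure E M" and E: "compact E"
    and T: "\<And>x y. dist (T x) (T y) = c * dist x y" and c: "c > 0"
  shows "homogeneous_measure (T ` E) (distr M borel T)"
proof -
  have M': "borel_prob_on E M" using M by (simp add: homogeneous_measure_def)
  have "compact (T ` E)"
    using compact_continuous_image[OF continuous_on_subset[OF similarity_borel(1)[OF T c]] E] by simp
  then have "borel_prob_on (T ` E) (distr M borel T)"
    by (intro borel_prob_on_distr M' similarity_borel(2)[OF T c]) (simp add: borel_compact)
  moreover have "measure (distr M borel T) (cball (T x) s) = measure (distr M borel T) (cball (T y) s)"
    if "s > 0" "x \<in> E" "y \<in> E" for s x y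
    unfolding measure_distr_cball_similarity[OF T c borel_prob_onD(1)[OF M']]
    using M that(2,3) divide_pos_pos[OF that(1) c] unfolding homogeneous_measure_def by blast
  ultimately show ?thesis unfolding homogeneous_measure_def by blast
qed

text \<open>An isometry that preserves \<open>M\<close> and sends \<open>x\<close> to
  \<open>y\<close> carries the ball at \<open>x\<close> to the ball at \<open>y\<close>. It is
  applied to translations of an ideal and to multiplication by units on a sphere.\<close>

lemma homogeneous_measure_transitive:
  assumes M: "borel_prob_on E M"
    and T: "\<And>x y. x \<in> E \<Longrightarrow> y \<in> E \<Longrightarrow>
      \<exists>T. T x = y \<and> (\<forall>u v. dist (T u) (T v) = dist u v) \<and> distr M borel T = M"
  shows "homogeneous_measure E M"
  unfolding homogeneous_measure_def
proof (intro conjI allI impI ballI M)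
  fix s :: real and x y assume "x \<in> E" "y \<in> E"
  with T obtain T where T: "T x = y" "\<And>u v. dist (T u) (T v) = dist u v" "distr M borel T = M"
    by blast
  show "measure M (cball x s) = measure M (cball y s)"
    using measure_distr_cball_similarity[of T 1 M x s] borel_prob_onD(1)[OF M] by (simp add: T)
qed

section \<open>Energy as a quadratic form in ball masses\<close>

text \<open>Mutual energy at a single scale: a finite bilinear form, symmetric in the two measures,
  on which squares can be completed.\<close>

lemma nn_integral_emeasure_cball:
  fixes E :: "'a::ultrametric_space set"
  assumes "compact E" "s > 0" "borel_prob_on E M" "borel_prob_on E N"
  shows "(\<integral>\<^sup>+ x. emeasure M (cball x s) \<partial>N) =
    ennreal (\<Sum>B\<in>(\<lambda>x. cball x s) ` E. measure M B * measure N B)"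
proof -
  interpret M: prob_space M by (rule borel_prob_onD(2)[OF assms(3)])
  interpret N: prob_space N by (rule borel_prob_onD(2)[OF assms(4)])
  show ?thesis
    unfolding nn_integral_cball[OF assms(1,2,4), of "emeasure M"]
    unfolding M.emeasure_eq_measure N.emeasure_eq_measure
    by (subst sum_ennreal[symmetric]) (simp_all add: ennreal_mult)
qed

text \<open>
  If the potential of \<open>M\<close> is constant on \<open>E\<close>, then the cross term in the expansion of the
  quadratic form at \<open>N - M\<close> does not depend on \<open>N\<close>.
\<close>

lemma energy_eq_plus_squares:
  fixes E :: "'a::ultrametric_space set"
  assumes E: "compact E" and M: "borel_prob_on E M" and N: "borel_prob_on E N"
    and s: "\<And>k. s k > 0"
    and pot: "\<And>y. y \<in> E \<Longrightarrow> (\<Sum>k. ennreal l * emeasure M (cball y (s k))) = ennreal V"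
  shows "(\<Sum>k. ennreal l * (\<integral>\<^sup>+ y. emeasure N (cball y (s k)) \<partial>N)) = ennreal V +
    (\<Sum>k. ennreal l * ennreal (\<Sum>B\<in>(\<lambda>x. cball x (s k)) ` E. (measure N B - measure M B)\<^sup>2))"
    (is "_ = _ + (\<Sum>k. _ * ennreal (?d k))")
proof -
  define g where "g k M N = (\<Sum>B\<in>(\<lambda>x. cball x (s k)) ` E. measure M B * measure N B)"
    for k and M N :: "'a measure"
  have g: "(\<integral>\<^sup>+ y. emeasure M (cball y (s k)) \<partial>N) = ennreal (g k M N)"
    if "borel_prob_on E M" "borel_prob_on E N" for k M N
    unfolding g_def by (rule nn_integral_emeasure_cball[OF E s that])
  \<comment> \<open>Integrate the constant potential of \<open>M\<close> against \<open>L\<close>;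
    this is needed for \<open>L = M\<close> and for \<open>L = N\<close>.\<close>
  have const: "(\<Sum>k. ennreal l * ennreal (g k M L)) = ennreal V" if L: "borel_prob_on E L" for L
  proof -
    note LD = borel_prob_onD[OF L]
    have meas: "(\<lambda>y. ennreal l * emeasure M (cball y (s k))) \<in> borel_measurable L" for k
      using cball_locally_constant_borel[OF s, of "\<lambda>B. ennreal l * emeasure M B" k] LD(1)
      by (simp cong: measurable_cong_sets)
    have meas': "(\<lambda>y. emeasure M (cball y (s k))) \<in> borel_measurable L" for k
      using cball_locally_constant_borel[OF s, of "\<lambda>B. emeasure M B" k] LD(1)
      by (simp cong: measurable_cong_sets)
    have "(\<Sum>k. ennreal l * ennreal (g k M L))
        = (\<Sum>k. \<integral>\<^sup>+ y. ennreal l * emeasure M (cball y (s k)) \<partial>L)"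
      by (simp only: g[OF M L, symmetric] nn_integral_cmult[OF meas'])
    also have "\<dots> = (\<integral>\<^sup>+ y. (\<Sum>k. ennreal l * emeasure M (cball y (s k))) \<partial>L)"
      by (rule nn_integral_suminf[OF meas, symmetric])
    also have "\<dots> = (\<integral>\<^sup>+ y. ennreal V \<partial>L)"
      by (intro nn_integral_cong_AE eventually_mono[OF LD(3)] pot)
    also have "\<dots> = ennreal V" using prob_space.emeasure_space_1[OF LD(2)] by simp
    finally show ?thesis .
  qed
  have nonneg: "0 \<le> g k A B" "0 \<le> ?d k" for k A B
    by (simp_all add: g_def sum_nonneg)
  \<comment> \<open>The expanded square with the mixed terms moved to the right, so that it can be
    summed over \<open>k\<close> in \<open>ennreal\<close> even when the energy of \<open>N\<close>
    is infinite.\<close>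
  have split: "ennreal (g k N N) + ennreal (g k M M)
      = ennreal (g k M N) + ennreal (g k M N) + ennreal (?d k)" for k
  proof -
    have "g k N N + g k M M = g k M N + g k M N + ?d k"
      unfolding g_def sum.distrib[symmetric]
      by (rule sum.cong) (auto simp: power2_eq_square algebra_simps)
    then show ?thesis using nonneg by (simp flip: ennreal_plus)
  qed
  let ?G = "\<lambda>A B. \<Sum>k. ennreal l * ennreal (g k A B)"
  have "ennreal V + ?G N N = ?G N N + ?G M M" by (simp only: const[OF M] add.commute)
  also have "\<dots> = ?G M N + ?G M N + (\<Sum>k. ennreal l * ennreal (?d k))"
    by (simp only: suminf_add[OF summableI summableI] distrib_left[symmetric] split)
  also have "\<dots> = ennreal V + (ennreal V + (\<Sum>k. ennreal l * ennreal (?d k)))"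
    by (simp only: const[OF N] add.assoc)
  \<comment> \<open>Only one copy of the finite \<open>ennreal V\<close> is cancelled;
    \<open>?G N N\<close> itself may be infinite.\<close>
  finally have "?G N N = ennreal V + (\<Sum>k. ennreal l * ennreal (?d k))"
    by (simp add: ennreal_add_left_cancel)
  then show ?thesis by (simp only: g[OF N N])
qed

section \<open>The valuation and the energy kernel\<close>

lemma absval_one [simp]: "absval (1 :: 'a::nonarch_local_field) = 1"
proof -
  have "absval (1 :: 'a) * absval (1 :: 'a) = absval (1 :: 'a)"
    by (simp flip: nonarch_absval_mult)
  then show ?thesis
    using nonarch_absval_eq_0_iff[of "1 :: 'a"] by simp
qed

lemma absval_zero [simp]: "absval (0 :: 'a::nonarch_local_field) = 0"
  by (simp add: nonarch_absval_eq_0_iff)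

lemma absval_pos: "x \<noteq> 0 \<Longrightarrow> 0 < absval (x :: 'a::nonarch_local_field)"
  using nonarch_absval_nonneg[of x] nonarch_absval_eq_0_iff[of x] by simp

lemma absval_inverse: "absval (inverse x) = inverse (absval (x :: 'a::nonarch_local_field))"
proof (cases "x = 0")
  case False
  then have "absval x * absval (inverse x) = 1" by (simp flip: nonarch_absval_mult)
  then show ?thesis by (simp add: inverse_unique)
qed simp

lemma absval_divide: "absval (x / y) = absval x / absval (y :: 'a::nonarch_local_field)"
  by (simp add: divide_inverse nonarch_absval_mult absval_inverse)

lemma absval_power: "absval (x ^ k) = absval (x :: 'a::nonarch_local_field) ^ k"
  by (induction k) (simp_all add: nonarch_absval_mult)

lemma absval_powi: "absval (x powi k) = absval (x :: 'a::nonarch_local_field) powi k"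
  by (simp add: power_int_def absval_power absval_inverse)

lemma absval_add_eq:
  fixes x y :: "'a::nonarch_local_field"
  assumes "absval y < absval x"
  shows "absval (x + y) = absval x"
  using nonarch_absval_add[of x y] nonarch_absval_diff[of "x + y" y] assms by simp

lemma absval_diff_eq:
  fixes x y :: "'a::nonarch_local_field"
  assumes "absval y < absval x"
  shows "absval (x - y) = absval x"
  using absval_add_eq[of "- y" x] assms by (simp add: nonarch_absval_minus)

lemma dist_mult: "dist (c * x) (c * y) = absval c * dist x (y :: 'a::nonarch_local_field)"
  by (simp add: nonarch_dist nonarch_absval_mult flip: right_diff_distrib)

lemma dist_add_left: "dist (c + x) (c + y) = dist x (y :: 'a::nonarch_local_field)"
  by (simp add: nonarch_dist)

lemma dist_zero: "dist 0 x = absval (x :: 'a::nonarch_local_field)"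
  by (simp add: nonarch_dist nonarch_absval_minus)

section \<open>Value group, fractional ideals and residue classes\<close>

locale uniformized_local_field =
  fixes \<pi> :: "'a::nonarch_local_field"
  assumes uniformizer: "uniformizer \<pi>"
begin

abbreviation "r \<equiv> absval \<pi>"

lemma absval_less_1_iff: "absval (x :: 'a) < 1 \<longleftrightarrow> (\<exists>y. x = \<pi> * y \<and> absval y \<le> 1)"
  using uniformizer unfolding uniformizer_def integer_ring_def by blast

lemma r_less_1: "r < 1"
  using absval_less_1_iff[of \<pi>] by (auto intro: exI[of _ 1])

text \<open>Nontriviality provides a nonzero element of the maximal ideal, so the generator of that
  ideal cannot be 0.\<close>

lemma r_pos: "0 < r"
proof -
  obtain x :: 'a where x: "x \<noteq> 0" "absval x \<noteq> 1" using nonarch_absval_nontrivial by blast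
  obtain y :: 'a where "y \<noteq> 0" "absval y < 1"
  proof (cases "absval x < 1")
    case False
    then have "absval (inverse x) < 1" using x by (simp add: absval_inverse inverse_less_1_iff)
    then show ?thesis using x that[of "inverse x"] by simp
  qed (use x that in blast)
  then have "\<pi> \<noteq> 0" by (auto simp: absval_less_1_iff)
  then show ?thesis by (rule absval_pos)
qed

lemma r_nonzero [simp]: "r \<noteq> 0"
  using r_pos by simp

lemma uniformizer_nonzero [simp]: "\<pi> \<noteq> 0"
  using r_pos by auto

lemma ln_r_neg: "ln r < 0"
  using r_pos r_less_1 by simp

lemma r_powi_pos: "0 < r powi k"
  using r_pos by simp

lemma r_powi_le_iff: "r powi j \<le> r powi k \<longleftrightarrow> k \<le> j"
proof -
  have *: "r powi j < r powi k" if "k < j" for j k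
    using power_int_strict_decreasing[OF that r_pos r_less_1] .
  show ?thesis
  proof
    assume le: "r powi j \<le> r powi k"
    show "k \<le> j"
    proof (rule ccontr)
      assume "\<not> k \<le> j"
      then have "r powi k < r powi j" by (intro *) simp
      with le show False by simp
    qed
  qed (cases "k = j"; simp add: less_imp_le *)
qed

lemma r_powi_less_iff: "r powi j < r powi k \<longleftrightarrow> k < j"
  using r_powi_le_iff[of k j] by linarith

lemma absval_less_1_imp_le: "absval (x :: 'a) < 1 \<Longrightarrow> absval x \<le> r"
  using r_pos by (auto simp: absval_less_1_iff nonarch_absval_mult mult_left_le)

lemma powi_between:
  assumes "0 < t"
  obtains m where "r powi (m + 1) < t" "t \<le> r powi m"
proof
  \<comment> \<open>The logarithm of \<open>t\<close> to base \<open>r\<close>; since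
    \<open>r < 1\<close> the order is reversed, and the exponent sought is its floor.\<close>
  define u where "u = ln t / ln r"
  have t: "t = r powr u" using assms r_pos ln_r_neg by (simp add: u_def powr_def)
  have le: "r powr a \<le> r powr b \<longleftrightarrow> b \<le> a" for a b :: real
    using r_pos ln_r_neg by (simp add: powr_def mult_le_cancel_right)
  have eq: "r powi k = r powr k" for k using r_pos by (simp add: powr_real_of_int')
  show "t \<le> r powi \<lfloor>u\<rfloor>" unfolding t eq le by simp
  have "\<not> r powr u \<le> r powr (\<lfloor>u\<rfloor> + 1)" unfolding le by linarith
  then show "r powi (\<lfloor>u\<rfloor> + 1) < t" unfolding t eq by simp
qed

text \<open>Discreteness of the value group. As \<pi> generates the maximal ideal, no absolute value
  lies strictly between \<open>r\<close> and 1, and dividing by a power of \<pi> moves any other gap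
  there.\<close>

lemma absval_eq_powi:
  assumes "(x :: 'a) \<noteq> 0"
  obtains m where "absval x = r powi m"
proof -
  obtain m where m: "r powi (m + 1) < absval x" "absval x \<le> r powi m"
    using powi_between absval_pos[OF assms] by blast
  have "absval x = r powi m"
  proof (rule ccontr)
    assume "absval x \<noteq> r powi m"
    with m(2) have "absval x < r powi m" by simp
    then have "absval (x / \<pi> powi m) < 1"
      using r_powi_pos[of m] by (simp add: absval_divide absval_powi)
    then have "absval (x / \<pi> powi m) \<le> r" by (rule absval_less_1_imp_le)
    then show False
      using m(1) r_powi_pos[of m] by (simp add: absval_divide absval_powi power_int_add field_simps)
  qed
  then show ?thesis using that by blast
qed

lemma absval_gap: "absval (x :: 'a) < r powi m \<longleftrightarrow> absval x \<le> r powi (m + 1)"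
proof (cases "x = 0")
  case True
  then show ?thesis using r_powi_pos[of m] r_powi_pos[of "m + 1"] by simp
next
  case False
  then obtain j where "absval x = r powi j" by (rule absval_eq_powi)
  then show ?thesis by (simp add: r_powi_le_iff r_powi_less_iff) presburger
qed

text \<open>By discreteness a radius may be rounded down to a power of \<open>r\<close>; the same
  exponent serves all centres at once.\<close>

lemma cball_eq_cball_powi:
  assumes "0 < s"
  obtains m where "\<And>x :: 'a. cball x s = cball x (r powi m)" "r powi m \<le> s"
proof -
  obtain m where m: "r powi (m + 1) < s" "s \<le> r powi m" using powi_between[OF assms] by blast
  show ?thesis
  proof (cases "s = r powi m")
    case False
    then have "absval z \<le> s \<longleftrightarrow> absval z \<le> r powi (m + 1)" for z :: 'a
      using m absval_gap[of z m] by linarith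
    then have "cball x s = cball x (r powi (m + 1))" for x :: 'a
      by (simp add: set_eq_iff nonarch_dist)
    then show ?thesis using m(1) that[of "m + 1"] by simp
  qed (use that in auto)
qed

lemma frac_ideal_eq_cball: "frac_ideal \<pi> k = cball 0 (r powi k)"
proof (intro equalityI subsetI)
  fix x :: 'a assume "x \<in> cball 0 (r powi k)"
  then have "x / \<pi> powi k \<in> integer_ring"
    using r_powi_pos[of k] by (simp add: integer_ring_def absval_divide absval_powi dist_zero)
  then show "x \<in> frac_ideal \<pi> k" by (force simp: frac_ideal_def)
qed (use r_powi_pos[of k] in \<open>auto simp: frac_ideal_def integer_ring_def dist_zero
      nonarch_absval_mult absval_powi mult_left_le\<close>)

lemma unit_group_eq: "unit_group = {x :: 'a. absval x = 1}"
proof (intro equalityI subsetI)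
  fix x :: 'a assume "x \<in> {x. absval x = 1}"
  then have "x \<noteq> 0" "absval x = 1" by auto
  then show "x \<in> unit_group"
    by (simp add: unit_group_def integer_ring_def)
      (intro exI[of _ "inverse x"], simp add: absval_inverse)
next
  fix x :: 'a assume "x \<in> unit_group"
  then obtain y where y: "absval x \<le> 1" "absval y \<le> 1" "x * y = 1"
    by (auto simp: unit_group_def integer_ring_def)
  have "absval x * absval y = 1" by (simp add: y(3) flip: nonarch_absval_mult)
  with y show "x \<in> {x. absval x = 1}"
    using mult_left_le[of "absval y" "absval x"] nonarch_absval_nonneg[of x] by simp
qed

lemma unit_sphere_eq_sphere: "unit_sphere \<pi> k = sphere 0 (r powi k)"
proof (intro equalityI subsetI)
  fix x :: 'a assume "x \<in> sphere 0 (r powi k)"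
  then have "x / \<pi> powi k \<in> unit_group"
    using r_powi_pos[of k] by (simp add: unit_group_eq absval_divide absval_powi dist_zero)
  then show "x \<in> unit_sphere \<pi> k" by (force simp: unit_sphere_def)
qed (auto simp: unit_sphere_def unit_group_eq dist_zero nonarch_absval_mult absval_powi)

lemma cball_0_scale: "(*) (\<pi> powi k) ` cball 0 (r powi j) = cball 0 (r powi (j + k))"
proof (intro equalityI subsetI)
  fix x :: 'a assume "x \<in> cball 0 (r powi (j + k))"
  then have "x / \<pi> powi k \<in> cball 0 (r powi j)"
    using r_powi_pos[of k]
    by (simp add: absval_divide absval_powi dist_zero power_int_add field_simps)
  then show "x \<in> (*) (\<pi> powi k) ` cball 0 (r powi j)" by (force simp: image_iff)
qed (use r_powi_pos[of k] in \<open>auto simp: dist_zero nonarch_absval_mult absval_powi power_int_add\<close>)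

text \<open>Local compactness at 0 yields one compact ball, and multiplication by powers of \<pi>
  carries it to all others.\<close>

lemma compact_cball_0: "compact (cball (0 :: 'a) (r powi k))"
proof -
  obtain U C where UC: "open U" "(0 :: 'a) \<in> U" "U \<subseteq> C" "compact C"
    using nonarch_locally_compact by blast
  then obtain e where e: "e > 0" "cball 0 e \<subseteq> U" by (meson open_contains_cball)
  obtain m where "cball (0 :: 'a) e = cball 0 (r powi m)" using cball_eq_cball_powi[OF e(1)] by metis
  with e UC have "cball 0 (r powi m) \<subseteq> C" by blast
  then have "compact (C \<inter> cball 0 (r powi m))" "C \<inter> cball 0 (r powi m) = cball 0 (r powi m)"
    using UC(4) by (auto intro: compact_Int_closed)
  then have "compact ((*) (\<pi> powi (k - m)) ` cball 0 (r powi m))"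
    using similarity_borel(1)[of "(*) (\<pi> powi (k - m))"] dist_mult absval_pos[of "\<pi> powi (k - m)"]
    by (metis compact_continuous_image continuous_on_subset power_int_eq_0_iff subset_UNIV
        uniformizer_nonzero)
  then show ?thesis by (simp add: cball_0_scale)
qed

lemma compact_frac_ideal: "compact (frac_ideal \<pi> k)"
  by (simp add: frac_ideal_eq_cball compact_cball_0)

lemma compact_unit_sphere: "compact (unit_sphere \<pi> k)"
proof -
  have "unit_sphere \<pi> k = cball 0 (r powi k) \<inter> - ball 0 (r powi k)"
    by (auto simp: unit_sphere_eq_sphere)
  then show ?thesis by (simp add: compact_Int_closed[OF compact_cball_0] closed_Compl)
qed

text \<open>The maximal ideal is the ball of radius \<open>r\<close> about 0, so its cosets are
  balls; finiteness of the residue field thereby follows from compactness.\<close>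

lemma residue_classes_eq: "residue_classes \<pi> = (\<lambda>x. cball x r) ` cball 0 1"
proof -
  have ideal: "(*) \<pi> ` integer_ring = {z. absval z \<le> r}"
    using uniformizer absval_less_1_imp_le r_less_1 unfolding uniformizer_def
    by (auto dest: le_less_trans)
  have "{(x, y). x \<in> integer_ring \<and> y \<in> integer_ring \<and> x - y \<in> (*) \<pi> ` integer_ring} `` {x} =
      cball x r" if "x \<in> integer_ring" for x :: 'a
  proof -
    have "y \<in> integer_ring" if "absval (x - y) \<le> r" for y
      using that \<open>x \<in> integer_ring\<close> nonarch_absval_diff[of x "x - y"] r_less_1
      by (simp add: integer_ring_def)
    with that show ?thesis by (auto simp: ideal nonarch_dist)
  qed
  moreover have "integer_ring = cball (0 :: 'a) 1"
    by (auto simp: integer_ring_def dist_zero)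
  ultimately show ?thesis
    unfolding residue_classes_def quotient_def by auto
qed

lemma finite_residue_classes: "finite (residue_classes \<pi>)"
  using finite_cballs[OF _ r_pos] compact_cball_0[of 0] by (simp add: residue_classes_eq)

lemma card_residue_classes_ge_2: "2 \<le> card (residue_classes \<pi>)"
proof -
  have "cball 0 r \<noteq> cball (1 :: 'a) r"
    using r_pos r_less_1 by (auto simp: set_eq_iff dist_zero intro!: exI[of _ 1])
  then have "card {cball 0 r, cball (1 :: 'a) r} = 2" by simp
  moreover have "{cball 0 r, cball (1 :: 'a) r} \<subseteq> residue_classes \<pi>"
    by (auto simp: residue_classes_eq dist_zero)
  ultimately show ?thesis using card_mono[OF finite_residue_classes] by metis
qed

section \<open>Layers of the logarithmic kernel and the criterion for equilibrium\<close>

lemma pair_norm_eq_powi: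
  assumes "x \<noteq> (0 :: 'a, 0 :: 'a)"
  obtains m where "pair_norm x = r powi m"
proof (cases "absval (fst x) \<le> absval (snd x)")
  case True
  then have "snd x \<noteq> 0"
    using assms nonarch_absval_nonneg[of "fst x"] nonarch_absval_eq_0_iff[of "fst x"]
    by (cases x) auto
  then show ?thesis using True that absval_eq_powi unfolding pair_norm_def by (metis max.absorb2)
next
  case False
  then have "fst x \<noteq> 0" using nonarch_absval_nonneg[of "snd x"] by auto
  then show ?thesis
    using False that absval_eq_powi unfolding pair_norm_def by (metis max.absorb1 linear)
qed

lemma sphere_dist_eq_power:
  fixes x y :: "'a proj_line"
  assumes "x \<noteq> y"
  obtains k where "sphere_dist x y = r ^ k"
proof -
  obtain a where a: "a \<noteq> (0, 0)" "x = abs_proj_line a" by (rule proj_line_cases)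
  obtain b where b: "b \<noteq> (0, 0)" "y = abs_proj_line b" by (rule proj_line_cases)
  obtain i where i: "pair_norm a = r powi i" using pair_norm_eq_powi[OF a(1)] .
  obtain j where j: "pair_norm b = r powi j" using pair_norm_eq_powi[OF b(1)] .
  have eq: "sphere_dist x y = absval (pair_wedge a b) / (pair_norm a * pair_norm b)"
    using a b by (simp add: sphere_dist_abs)
  with assms have "pair_wedge a b \<noteq> 0" using sphere_dist_eq_0_iff[of x y] by auto
  then obtain m where "absval (pair_wedge a b) = r powi m" by (rule absval_eq_powi)
  then have *: "sphere_dist x y = r powi (m - (i + j))"
    by (simp add: eq i j power_int_diff power_int_add)
  then have "r powi (m - (i + j)) \<le> r powi 0" using sphere_dist_le_1[of x y] by simp
  then have "0 \<le> m - (i + j)" by (simp only: r_powi_le_iff)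
  then show ?thesis using that[of "nat (m - (i + j))"] * by (simp add: power_int_def)
qed

lemma neg_log_dist_layers:
  fixes x y :: "'a proj_line"
  shows "neg_log_dist x y = (\<Sum>k. ennreal (- ln r) * indicator (cball y (r ^ Suc k)) x)"
proof (cases "x = y")
  case True
  \<comment> \<open>On the diagonal every layer counts, and a constant positive series diverges,
    matching the value of the kernel there.\<close>
  have "(\<Sum>k::nat. ennreal (- ln r)) = (\<integral>\<^sup>+ k. ennreal (- ln r) \<partial>count_space (UNIV :: nat set))"
    by (simp only: nn_integral_count_space_nat)
  also have "\<dots> = \<infinity>"
    using ln_r_neg by (simp add: ennreal_mult_top ennreal_eq_0_iff)
  finally show ?thesis using True r_pos by (simp add: neg_log_dist_def)
next
  case False
  then obtain m where m: "sphere_dist x y = r ^ m" by (rule sphere_dist_eq_power)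
  \<comment> \<open>The radii start at \<open>r ^ 1\<close>: the ball of radius 1 is the whole
    projective line and must not be counted. Hence distance \<open>r ^ m\<close> means exactly
    \<open>m\<close> layers.\<close>
  have mem: "x \<in> cball y (r ^ Suc k) \<longleftrightarrow> k < m" for k
  proof -
    have "x \<in> cball y (r ^ Suc k) \<longleftrightarrow> r powi int m \<le> r powi int (Suc k)"
      by (simp only: mem_cball dist_proj_line_def sphere_dist_commute[of y] m power_int_of_nat)
    then show ?thesis unfolding r_powi_le_iff by auto
  qed
  have "(\<Sum>k. ennreal (- ln r) * indicator (cball y (r ^ Suc k)) x)
      = (\<Sum>k<m. ennreal (- ln r) * indicator (cball y (r ^ Suc k)) x)"
    by (rule suminf_finite) (simp_all only: finite_lessThan lessThan_iff indicator_simps mem simp_thms mult_zero_right)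
  also have "\<dots> = (\<Sum>k<m. ennreal (- ln r))"
    by (rule sum.cong) (simp_all only: lessThan_iff indicator_simps mem mult_1_right)
  also have "\<dots> = ennreal (- ln (sphere_dist x y))"
    using r_pos ln_r_neg by (simp add: m ln_realpow ennreal_of_nat_eq_real_of_nat flip: ennreal_mult)
  finally show ?thesis using False by (simp add: neg_log_dist_def)
qed

lemma nn_integral_neg_log_dist:
  fixes M :: "'a proj_line measure"
  assumes "sets M = sets borel"
  shows "(\<integral>\<^sup>+ x. neg_log_dist x y \<partial>M) = (\<Sum>k. ennreal (- ln r) * emeasure M (cball y (r ^ Suc k)))"
proof -
  have S: "cball y (r ^ Suc k) \<in> sets M" for k
    unfolding assms by (rule borel_closed) (rule closed_cball)
  have "(\<integral>\<^sup>+ x. neg_log_dist x y \<partial>M) =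
      (\<Sum>k. \<integral>\<^sup>+ x. ennreal (- ln r) * indicator (cball y (r ^ Suc k)) x \<partial>M)"
    unfolding neg_log_dist_layers
    by (rule nn_integral_suminf)
      (rule borel_measurable_times_ennreal[OF borel_measurable_const borel_measurable_indicator[OF S]])
  then show ?thesis by (simp only: nn_integral_cmult_indicator[OF S])
qed

lemma energy_eq_suminf:
  fixes M :: "'a proj_line measure"
  assumes "borel_prob_on E M"
  shows "energy M = (\<Sum>k. ennreal (- ln r) * (\<integral>\<^sup>+ y. emeasure M (cball y (r ^ Suc k)) \<partial>M))"
proof -
  note MD = borel_prob_onD[OF assms]
  have meas: "(\<lambda>y. F (emeasure M (cball y (r ^ Suc k)))) \<in> borel_measurable M"
    for k and F :: "ennreal \<Rightarrow> ennreal"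
    using cball_locally_constant_borel[of "r ^ Suc k" "\<lambda>B. F (emeasure M B)"] r_pos
    by (simp only: measurable_cong_sets[OF MD(1) refl] zero_less_power)
  show ?thesis
    unfolding energy_def nn_integral_neg_log_dist[OF MD(1)] nn_integral_cmult[OF meas[of "\<lambda>x. x"], symmetric]
    by (rule nn_integral_suminf[OF meas])
qed

theorem equilibrium_if_potential_constant:
  fixes E :: "'a proj_line set"
  assumes E: "compact E" and M: "borel_prob_on E M"
    and pot: "\<And>y. y \<in> E \<Longrightarrow> (\<integral>\<^sup>+ x. neg_log_dist x y \<partial>M) = ennreal V"
  shows "equilibrium_measure E M" "robin_const E = ennreal V"
proof -
  define d where "d N = (\<Sum>k. ennreal (- ln r) * ennreal (\<Sum>B\<in>(\<lambda>x. cball x (r ^ Suc k)) ` E.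
    (measure N B - measure M B)\<^sup>2))" for N
  have energy: "energy N = ennreal V + d N" if "borel_prob_on E N" for N
    unfolding energy_eq_suminf[OF that] d_def
    using energy_eq_plus_squares[OF E M that, of "\<lambda>k. r ^ Suc k" "- ln r" V] r_pos pot
    by (simp only: nn_integral_neg_log_dist[OF borel_prob_onD(1)[OF M]] zero_less_power)
  have "d M = 0" by (simp add: d_def)
  then have VM: "energy M = ennreal V" using energy[OF M] by simp
  show R: "robin_const E = ennreal V"
    unfolding robin_const_def
  proof (rule antisym)
    show "(INF N\<in>{N. borel_prob_on E N}. energy N) \<le> ennreal V"
      using M VM by (intro INF_lower2[of M]) auto
  qed (auto simp: energy intro!: INF_greatest)
  show "equilibrium_measure E M"
    unfolding equilibrium_measure_def R
  proof (intro conjI allI impI M VM)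
    fix N assume "borel_prob_on E N \<and> energy N = ennreal V"
    then have N: "borel_prob_on E N" and "ennreal V + d N = ennreal V + 0"
      using energy[of N] by simp_all
    \<comment> \<open>The cancellation is legitimate because \<open>ennreal V\<close> is
      finite.\<close>
    then have "d N = 0" by (simp only: ennreal_add_left_cancel) simp
    then have *: "(\<Sum>B\<in>(\<lambda>x. cball x (r ^ Suc k)) ` E. (measure N B - measure M B)\<^sup>2) = 0" for k
      using ln_r_neg
      by (auto simp: d_def suminf_eq_zero_iff ennreal_eq_0_iff sum_nonneg intro!: antisym dest!: fun_cong[of _ _ k])
    have eq: "measure N (cball x (r ^ Suc k)) = measure M (cball x (r ^ Suc k))" if "x \<in> E" for x k
    proof -
      \<comment> \<open>Finiteness matters: a sum over an infinite index set would be 0 by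
        convention and say nothing about its terms.\<close>
      have "finite ((\<lambda>x. cball x (r ^ Suc k)) ` E)"
        using r_pos by (intro finite_cballs E) simp
      then have "\<forall>B\<in>(\<lambda>x. cball x (r ^ Suc k)) ` E. (measure N B - measure M B)\<^sup>2 = 0"
        using *[of k] by (subst (asm) sum_nonneg_eq_0_iff) auto
      then show ?thesis using that by simp
    qed
    show "N = M"
    proof (rule borel_prob_on_eqI[OF E N M])
      fix e :: real assume "e > 0"
      obtain k where "r ^ k < e" using real_arch_pow_inv[OF \<open>e > 0\<close> r_less_1] by blast
      moreover have "r ^ Suc k \<le> r ^ k" using r_pos r_less_1 by (intro power_decreasing) simp_all
      ultimately have "r ^ Suc k < e" by (rule order.strict_trans1[rotated])
      with eq show "\<exists>s. 0 < s \<and> s < e \<and> (\<forall>x\<in>E. measure N (cball x s) = measure M (cball x s))"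
        using r_pos by (intro exI[of _ "r ^ Suc k"]) simp
    qed
  qed
qed

end

section \<open>Haar measures\<close>

context uniformized_local_field
begin

abbreviation "q \<equiv> card (residue_classes \<pi>)"

section \<open>Haar measure on \<open>integer_ring\<close> as the law of a random digit
  series\<close>

text \<open>One representative is chosen from each residue class. The property is phrased by
  distance so that it can be applied to the rescaled remainders of a digit expansion.\<close>

lemma exists_digits:
  obtains D where "finite D" "D \<subseteq> cball (0 :: 'a) 1" "card D = q"
    "\<And>x. x \<in> cball 0 1 \<Longrightarrow> \<exists>d\<in>D. \<forall>e\<in>D. absval (x - e) \<le> r \<longleftrightarrow> e = d"
proof
  define f where "f C = (SOME x :: 'a. x \<in> cball 0 1 \<and> cball x r = C)" for C
  have f: "f C \<in> cball 0 1" "cball (f C) r = C" if "C \<in> residue_classes \<pi>" for C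
    using that someI_ex[of "\<lambda>x :: 'a. x \<in> cball 0 1 \<and> cball x r = C"]
    unfolding f_def residue_classes_eq by blast+
  show "finite (f ` residue_classes \<pi>)" using finite_residue_classes by simp
  show "f ` residue_classes \<pi> \<subseteq> cball 0 1" using f(1) by blast
  have "inj_on f (residue_classes \<pi>)" using f(2) by (metis inj_onI)
  then show "card (f ` residue_classes \<pi>) = q" by (rule card_image)
  fix x :: 'a assume "x \<in> cball 0 1"
  then have x: "cball x r \<in> residue_classes \<pi>" by (auto simp: residue_classes_eq)
  show "\<exists>d\<in>f ` residue_classes \<pi>. \<forall>e\<in>f ` residue_classes \<pi>. absval (x - e) \<le> r \<longleftrightarrow> e = d"
  proof (intro bexI[of _ "f (cball x r)"] ballI)
    fix e assume "e \<in> f ` residue_classes \<pi>"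
    then obtain C where C: "C \<in> residue_classes \<pi>" "e = f C" by blast
    have "absval (x - e) \<le> r \<longleftrightarrow> e \<in> cball x r" by (simp add: nonarch_dist)
    also have "\<dots> \<longleftrightarrow> cball e r = cball x r"
      using cball_eq_cball[of e x r] r_pos by force
    also have "\<dots> \<longleftrightarrow> e = f (cball x r)"
      using f(2) C x by metis
    finally show "absval (x - e) \<le> r \<longleftrightarrow> e = f (cball x r)" .
  qed (use x in simp)
qed

lemma homogeneous_measureI:
  assumes "borel_prob_on E M"
    and "\<And>m x. x \<in> E \<Longrightarrow> measure M (cball (x :: 'a) (r powi m)) = c m"
  shows "homogeneous_measure E M"
  unfolding homogeneous_measure_def
proof (intro conjI allI impI ballI assms(1))
  fix s :: real and x y assume "0 < s" and xy: "x \<in> E" "y \<in> E"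
  obtain m where "\<forall>x :: 'a. cball x s = cball x (r powi m)"
    using cball_eq_cball_powi[OF \<open>0 < s\<close>] by metis
  then show "measure M (cball x s) = measure M (cball y s)"
    using assms(2)[OF xy(1)] assms(2)[OF xy(2)] by metis
qed

text \<open>The next digit is that of the remainder \<open>(x - S d N) / \<pi> ^ N\<close>, which
  lies in the unit ball by induction. The equivalence for all sequences \<open>a\<close> turns balls
  into cylinder sets. Only the first \<open>N\<close> entries of \<open>d\<close> matter, so the
  witness may depend on \<open>N\<close>.\<close>

lemma digit_expansion:
  fixes D :: "'a set" and x :: 'a
  defines "S \<equiv> \<lambda>(a :: nat \<Rightarrow> 'a) N. \<Sum>i<N. a i * \<pi> ^ i"
  assumes D: "D \<subseteq> cball 0 1"
    "\<And>x. x \<in> cball 0 1 \<Longrightarrow> \<exists>d\<in>D. \<forall>e\<in>D. absval (x - e) \<le> r \<longleftrightarrow> e = d"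
    and x: "x \<in> cball 0 1"
  shows "\<exists>d. (\<forall>i. d i \<in> D) \<and>
    (\<forall>a. (\<forall>i. a i \<in> D) \<longrightarrow> (absval (x - S a N) \<le> r ^ N \<longleftrightarrow> (\<forall>i<N. a i = d i)))"
proof (induction N)
  case 0
  obtain e where "e \<in> D" using D(2)[OF x] by blast
  then show ?case using x by (intro exI[of _ "\<lambda>_. e"]) (auto simp: S_def dist_zero)
next
  case (Suc N)
  then obtain d where d: "\<And>i. d i \<in> D"
    "\<And>a. (\<And>i. a i \<in> D) \<Longrightarrow> absval (x - S a N) \<le> r ^ N \<longleftrightarrow> (\<forall>i<N. a i = d i)"
    by blast
  define y where "y = (x - S d N) / \<pi> ^ N"
  have "absval (x - S d N) \<le> r ^ N" using d by blast
  then have "y \<in> cball 0 1" using r_pos by (simp add: y_def dist_zero absval_divide absval_power)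
  then obtain e where e: "e \<in> D" "\<And>c. c \<in> D \<Longrightarrow> absval (y - c) \<le> r \<longleftrightarrow> c = e"
    using D(2) by blast
  show ?case
  proof (intro exI[of _ "d(N := e)"] conjI allI impI)
    fix i show "(d(N := e)) i \<in> D" using d e by simp
  next
    fix a :: "nat \<Rightarrow> 'a" assume "\<forall>i. a i \<in> D"
    then have a: "\<And>i. a i \<in> D" by blast
    have S: "S a (Suc N) = S a N + a N * \<pi> ^ N" by (simp add: S_def)
    have step: "absval (x - S a (Suc N)) \<le> r ^ Suc N \<longleftrightarrow> a N = e" if "\<forall>i<N. a i = d i"
    proof -
      have "S a N = S d N" using that by (simp add: S_def)
      then have "x - S a (Suc N) = (y - a N) * \<pi> ^ N" by (simp add: S y_def field_simps)
      then show ?thesis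
        using r_pos e(2)[OF a] by (simp add: nonarch_absval_mult absval_power)
    qed
    have "absval (a N) \<le> 1" using a D(1) by (force simp: dist_zero)
    then have last: "absval (a N * \<pi> ^ N) \<le> r ^ N"
      using r_pos by (simp add: nonarch_absval_mult absval_power mult_left_le_one_le nonarch_absval_nonneg)
    \<comment> \<open>Dropping the last term costs at most \<open>r ^ N\<close>, so closeness at
      stage \<open>N + 1\<close> forces closeness at stage \<open>N\<close>, and the induction
      hypothesis determines the earlier digits.\<close>
    have "absval (x - S a N) \<le> r ^ N" if "absval (x - S a (Suc N)) \<le> r ^ Suc N"
    proof -
      have pw: "r ^ Suc N \<le> r ^ N" using r_pos r_less_1 by (intro power_decreasing) simp_all
      have "x - S a N = (x - S a (Suc N)) + a N * \<pi> ^ N" by (simp add: S)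
      also have "absval \<dots> \<le> max (absval (x - S a (Suc N))) (absval (a N * \<pi> ^ N))"
        by (rule nonarch_absval_add)
      also have "\<dots> \<le> r ^ N"
        using order_trans[OF that pw] last by simp
      finally show ?thesis .
    qed
    then have "absval (x - S a (Suc N)) \<le> r ^ Suc N \<longleftrightarrow> (\<forall>i<N. a i = d i) \<and> a N = e"
      unfolding d(2)[OF a] using step by metis
    then show "absval (x - S a (Suc N)) \<le> r ^ Suc N \<longleftrightarrow> (\<forall>i<Suc N. a i = (d(N := e)) i)"
      by (auto simp: less_Suc_eq)
  qed
qed

text \<open>Ultrametrically a block of terms is bounded by its largest one, whence the clean bound
  \<open>r ^ N\<close>. Completeness comes from compactness of the unit ball.\<close>

lemma digit_series_converges:
  fixes a :: "nat \<Rightarrow> 'a"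
  defines "S \<equiv> \<lambda>N. \<Sum>i<N. a i * \<pi> ^ i"
  assumes a: "\<And>i. a i \<in> cball 0 1"
  obtains y where "S \<longlonglongrightarrow> y" "y \<in> cball 0 1" "\<And>N. absval (S N - y) \<le> r ^ N"
proof -
  have tail: "absval (S N - S (N + k)) \<le> r ^ N" for N k
  proof (induction k)
    case (Suc k)
    have "absval (a (N + k) * \<pi> ^ (N + k)) \<le> r ^ (N + k)"
      using r_pos a[of "N + k"]
      by (simp add: nonarch_absval_mult absval_power mult_left_le_one_le nonarch_absval_nonneg dist_zero)
    also have "\<dots> \<le> r ^ N" using r_pos r_less_1 by (intro power_decreasing) simp_all
    finally show ?case
      using Suc nonarch_absval_diff[of "S N - S (N + k)" "a (N + k) * \<pi> ^ (N + k)"]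
      by (simp add: S_def algebra_simps)
  qed (use r_pos in simp)
  have "Cauchy S"
  proof (rule metric_CauchyI)
    fix e :: real assume "0 < e"
    then obtain N where N: "r ^ N < e" using real_arch_pow_inv r_less_1 by blast
    have "dist (S i) (S j) < e" if "i \<ge> N" "j \<ge> N" for i j
    proof -
      have "dist (S N) (S i) \<le> r ^ N" "dist (S N) (S j) \<le> r ^ N"
        using tail[of N "i - N"] tail[of N "j - N"] that by (simp_all add: nonarch_dist)
      then show ?thesis using ultrametric[of "S i" "S j" "S N"] N by (simp add: dist_commute)
    qed
    then show "\<exists>M. \<forall>m\<ge>M. \<forall>n\<ge>M. dist (S m) (S n) < e" by blast
  qed
  moreover have "S N \<in> cball 0 1" for N
    using tail[of 0 N] by (simp add: S_def nonarch_dist)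
  moreover have "compact (cball (0 :: 'a) 1)"
    using compact_cball_0[of 0] by simp
  ultimately obtain y where y: "S \<longlonglongrightarrow> y" "y \<in> cball 0 1"
    using completeE[OF compact_imp_complete] by metis
  have "absval (S N - y) \<le> r ^ N" for N
  proof -
    have "y \<in> cball (S N) (r ^ N)"
    proof (rule closed_sequentially[OF closed_cball])
      show "(\<lambda>k. S (k + N)) \<longlonglongrightarrow> y" using y(1) by (rule LIMSEQ_ignore_initial_segment)
      show "\<And>k. S (k + N) \<in> cball (S N) (r ^ N)"
        using tail[of N] by (simp add: nonarch_dist add.commute)
    qed
    then show ?thesis by (simp add: nonarch_dist)
  qed
  with y show ?thesis by (rule that)
qed

text \<open>The law of the series with independent, uniformly distributed digits: lying in a ball of
  radius \<open>r ^ N\<close> prescribes \<open>N\<close> digits, each with probability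
  \<open>1 / q\<close>.\<close>

lemma exists_haar_integer_ring:
  obtains H :: "'a measure" where "borel_prob_on (cball 0 1) H"
    "\<And>x N. x \<in> cball 0 1 \<Longrightarrow> measure H (cball x (r ^ N)) = (1 / q) ^ N"
proof -
  obtain D where D: "finite D" "D \<subseteq> cball (0 :: 'a) 1" "card D = q"
    "\<And>x. x \<in> cball 0 1 \<Longrightarrow> \<exists>d\<in>D. \<forall>e\<in>D. absval (x - e) \<le> r \<longleftrightarrow> e = d"
    using exists_digits by blast
  have "D \<noteq> {}" using D(3) card_residue_classes_ge_2 by auto
  define U where "U = uniform_count_measure D"
  define P where "P = (\<Pi>\<^sub>M i\<in>(UNIV :: nat set). U)"
  define S where "S a N = (\<Sum>i<N. a i * \<pi> ^ i)" for a :: "nat \<Rightarrow> 'a" and N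
  interpret U: prob_space U
    unfolding U_def by (rule prob_space_uniform_count_measure[OF D(1) \<open>D \<noteq> {}\<close>])
  interpret P: product_prob_space "\<lambda>_. U" "UNIV :: nat set" ..
  have spU: "space U = D" "sets U = Pow D" by (simp_all add: U_def space_uniform_count_measure sets_uniform_count_measure)
  have U_sets: "sets (count_space D) = sets U" by (simp add: spU)
  have spP: "a \<in> space P \<longleftrightarrow> (\<forall>i. a i \<in> D)" for a
    by (auto simp: P_def space_PiM spU)
  have "\<exists>y. S a \<longlonglongrightarrow> y \<and> y \<in> cball 0 1 \<and> (\<forall>N. absval (S a N - y) \<le> r ^ N)"
    if "a \<in> space P" for a
  proof -
    have "a i \<in> cball 0 1" for i using that D(2) by (auto simp: spP)
    from digit_series_converges[of a, OF this] show ?thesis unfolding S_def by metis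
  qed
  then obtain L where L: "\<And>a. a \<in> space P \<Longrightarrow> S a \<longlonglongrightarrow> L a"
    "\<And>a. a \<in> space P \<Longrightarrow> L a \<in> cball 0 1"
    "\<And>a N. a \<in> space P \<Longrightarrow> absval (S a N - L a) \<le> r ^ N"
    by metis
  \<comment> \<open>A partial sum depends on finitely many digits from a finite set, so it is
    measurable even for the discrete sigma-algebra; this bypasses measurability of the field
    operations.\<close>
  have S: "(\<lambda>a. S a N) \<in> measurable P (count_space UNIV)" for N
  proof (induction N)
    case (Suc N)
    have "(\<lambda>a. a N) \<in> measurable P (count_space D)"
      unfolding P_def measurable_cong_sets[OF refl U_sets] by simp
    moreover have "(\<lambda>a. S a N + e * \<pi> ^ N) \<in> measurable P (count_space UNIV)" for e
      using measurable_compose[OF Suc, of "\<lambda>s. s + e * \<pi> ^ N" "count_space UNIV"] by simp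
    ultimately have "(\<lambda>a. S a N + a N * \<pi> ^ N) \<in> measurable P (count_space UNIV)"
      using measurable_compose_countable'[of D "\<lambda>e a. S a N + e * \<pi> ^ N"] countable_finite[OF D(1)]
      by blast
    then show ?case by (simp add: S_def)
  qed (simp add: S_def)
  have "(\<lambda>a. S a N) \<in> borel_measurable P" for N
    using measurable_compose[OF S, of "\<lambda>x. x"] by simp
  then have L_borel: "L \<in> borel_measurable P"
    by (rule borel_measurable_LIMSEQ_metric) (rule L(1))
  define H where "H = distr P borel L"
  have "prob_space P" unfolding P_def by (intro prob_space_PiM U.prob_space_axioms)
  then have "prob_space H" unfolding H_def using L_borel by (rule prob_space.prob_space_distr)
  moreover have "AE x in H. x \<in> cball 0 1"
    unfolding H_def using L(2) borel_closed[OF closed_cball[of 0 1]]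
    by (subst AE_distr_iff[OF L_borel]) (auto simp: cball_def)
  moreover have "sets H = sets borel" by (simp add: H_def)
  ultimately have "borel_prob_on (cball 0 1) H" unfolding borel_prob_on_def by blast
  moreover have "measure H (cball x (r ^ N)) = (1 / q) ^ N" if x: "x \<in> cball 0 1" for x N
  proof -
    obtain d where d: "\<And>i. d i \<in> D" "\<And>a. (\<And>i. a i \<in> D) \<Longrightarrow>
        absval (x - S a N) \<le> r ^ N \<longleftrightarrow> (\<forall>i<N. a i = d i)"
      using digit_expansion[OF D(2,4) x, of N] unfolding S_def by blast
    \<comment> \<open>The limit and the partial sum are within \<open>r ^ N\<close> of each other,
      hence lie in the same balls of that radius.\<close>
    have iff: "L a \<in> cball x (r ^ N) \<longleftrightarrow> (\<forall>i\<in>{..<N}. a i \<in> {d i})" if a: "a \<in> space P" for a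
    proof -
      have "L a \<in> cball x (r ^ N) \<longleftrightarrow> S a N \<in> cball x (r ^ N)"
        using L(3)[OF a, of N] ultrametric[of x "L a" "S a N"] ultrametric[of x "S a N" "L a"]
        by (auto simp: nonarch_dist[of "S a N"] dist_commute[of "L a"])
      then show ?thesis using d(2)[of a] a by (simp add: spP nonarch_dist Ball_def)
    qed
    have "emeasure H (cball x (r ^ N)) = emeasure P {a \<in> space P. \<forall>i\<in>{..<N}. a i \<in> {d i}}"
      unfolding H_def using iff
      by (subst emeasure_distr[OF L_borel]) (auto intro!: arg_cong[where f = "emeasure P"])
    also have "\<dots> = (\<Prod>i\<in>{..<N}. emeasure U {d i})"
      unfolding P_def by (rule P.emeasure_PiM_Collect) (use d in \<open>auto simp: spU\<close>)
    also have "\<dots> = (\<Prod>i\<in>{..<N}. ennreal (1 / q))"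
      using d(1) D(1) by (intro prod.cong) (simp_all add: U_def emeasure_uniform_count_measure D(3))
    also have "\<dots> = ennreal ((1 / q) ^ N)"
      by (simp add: ennreal_power)
    finally show ?thesis by (simp add: measure_def)
  qed
  ultimately show ?thesis by (rule that)
qed

section \<open>Haar measures on ideals and spheres\<close>

lemma add_frac_ideal: "a \<in> frac_ideal \<pi> k \<Longrightarrow> (+) a ` frac_ideal \<pi> k = frac_ideal \<pi> k"
proof -
  have sub: "(+) a ` frac_ideal \<pi> k \<subseteq> frac_ideal \<pi> k" if "a \<in> frac_ideal \<pi> k" for a
  proof (rule image_subsetI)
    fix x assume "x \<in> frac_ideal \<pi> k"
    with that show "a + x \<in> frac_ideal \<pi> k"
      using nonarch_absval_add[of a x] by (simp add: frac_ideal_eq_cball dist_zero)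
  qed
  assume a: "a \<in> frac_ideal \<pi> k"
  then have "- a \<in> frac_ideal \<pi> k" by (simp add: frac_ideal_eq_cball dist_zero nonarch_absval_minus)
  then have "(+) (- a) ` frac_ideal \<pi> k \<subseteq> frac_ideal \<pi> k" by (rule sub)
  moreover have "x = a + (- a + x)" for x by simp
  ultimately have "frac_ideal \<pi> k \<subseteq> (+) a ` frac_ideal \<pi> k" by blast
  with sub[OF a] show ?thesis by blast
qed

lemma mult_unit_sphere: "u \<in> unit_group \<Longrightarrow> (*) u ` unit_sphere \<pi> k = unit_sphere \<pi> k"
proof -
  have sub: "(*) u ` unit_sphere \<pi> k \<subseteq> unit_sphere \<pi> k" if "u \<in> unit_group" for u
    using that by (auto simp: unit_sphere_eq_sphere unit_group_eq dist_zero nonarch_absval_mult)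
  assume u: "u \<in> unit_group"
  then have u0: "u \<noteq> 0" and "inverse u \<in> unit_group" by (auto simp: unit_group_eq absval_inverse)
  then have "(*) (inverse u) ` unit_sphere \<pi> k \<subseteq> unit_sphere \<pi> k" by (intro sub)
  moreover have "x = u * (inverse u * x)" for x using u0 by simp
  ultimately have "unit_sphere \<pi> k \<subseteq> (*) u ` unit_sphere \<pi> k" by blast
  with sub[OF u] show ?thesis by blast
qed

text \<open>Invariance and homogeneity are equivalent here. A translate of a homogeneous measure is
  homogeneous on the same ideal, hence equal to it; conversely, translations are isometries acting
  transitively. So \<open>THE\<close> has exactly one solution.\<close>

lemma add_haar_eq:
  assumes H: "homogeneous_measure (frac_ideal \<pi> k) H"
  shows "add_haar \<pi> k = H"
  unfolding add_haar_def
proof (rule the_equality)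
  show "borel_prob_on (frac_ideal \<pi> k) H \<and> (\<forall>a\<in>frac_ideal \<pi> k. distr H borel ((+) a) = H)"
  proof (intro conjI ballI)
    show "borel_prob_on (frac_ideal \<pi> k) H" using H by (simp add: homogeneous_measure_def)
    fix a assume "a \<in> frac_ideal \<pi> k"
    then have "homogeneous_measure (frac_ideal \<pi> k) (distr H borel ((+) a))"
      using homogeneous_measure_similarity[OF H compact_frac_ideal, of "(+) a" 1]
      by (simp add: dist_add_left add_frac_ideal)
    then show "distr H borel ((+) a) = H"
      by (rule homogeneous_measure_unique[OF compact_frac_ideal _ H])
  qed
next
  fix M assume M: "borel_prob_on (frac_ideal \<pi> k) M \<and> (\<forall>a\<in>frac_ideal \<pi> k. distr M borel ((+) a) = M)"
  have "homogeneous_measure (frac_ideal \<pi> k) M"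
  proof (rule homogeneous_measure_transitive)
    fix x y assume xy: "x \<in> frac_ideal \<pi> k" "y \<in> frac_ideal \<pi> k"
    then have "y - x \<in> frac_ideal \<pi> k"
      using nonarch_absval_diff[of y x] by (simp add: frac_ideal_eq_cball dist_zero)
    then show "\<exists>T. T x = y \<and> (\<forall>u v. dist (T u) (T v) = dist u v) \<and> distr M borel T = M"
      using M by (intro exI[of _ "(+) (y - x)"]) (simp add: dist_add_left)
  qed (use M in simp)
  then show "M = H" by (rule homogeneous_measure_unique[OF compact_frac_ideal _ H])
qed

text \<open>The argument of \<open>add_haar_eq\<close> with units for translations: on a sphere
  \<open>y / x\<close> is a unit, and multiplication by units is isometric.\<close>

lemma mult_haar_eq:
  assumes H: "homogeneous_measure (unit_sphere \<pi> k) H"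
  shows "mult_haar \<pi> k = H"
  unfolding mult_haar_def
proof (rule the_equality)
  show "borel_prob_on (unit_sphere \<pi> k) H \<and> (\<forall>u\<in>unit_group. distr H borel ((*) u) = H)"
  proof (intro conjI ballI)
    show "borel_prob_on (unit_sphere \<pi> k) H" using H by (simp add: homogeneous_measure_def)
    fix u :: 'a assume u: "u \<in> unit_group"
    then have "homogeneous_measure (unit_sphere \<pi> k) (distr H borel ((*) u))"
      using homogeneous_measure_similarity[OF H compact_unit_sphere dist_mult, of u]
      by (simp add: mult_unit_sphere) (simp add: unit_group_eq)
    then show "distr H borel ((*) u) = H"
      by (rule homogeneous_measure_unique[OF compact_unit_sphere _ H])
  qed
next
  fix M assume M: "borel_prob_on (unit_sphere \<pi> k) M \<and> (\<forall>u\<in>unit_group. distr M borel ((*) u) = M)"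
  have "homogeneous_measure (unit_sphere \<pi> k) M"
  proof (rule homogeneous_measure_transitive)
    fix x y assume xy: "x \<in> unit_sphere \<pi> k" "y \<in> unit_sphere \<pi> k"
    then have "absval x = r powi k" "absval y = r powi k"
      by (simp_all add: unit_sphere_eq_sphere dist_zero)
    then have "y / x * x = y" "absval (y / x) = 1"
      using r_powi_pos[of k] by (auto simp: absval_divide)
    then show "\<exists>T. T x = y \<and> (\<forall>u v. dist (T u) (T v) = dist u v) \<and> distr M borel T = M"
      using M by (intro exI[of _ "(*) (y / x)"]) (simp only: dist_mult unit_group_eq mem_Collect_eq mult_1 simp_thms)
  qed (use M in simp)
  then show "M = H" by (rule homogeneous_measure_unique[OF compact_unit_sphere _ H])
qed

lemma measure_eq_1_if_superset:
  assumes "borel_prob_on E M" "E \<subseteq> A" "A \<in> sets borel"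
  shows "measure M A = 1"
proof -
  note MD = borel_prob_onD[OF assms(1)]
  have "AE x in M. x \<in> A" using MD(3) by (rule eventually_mono) (use assms(2) in blast)
  then show ?thesis
    using prob_space.prob_eq_1[OF MD(2), of A] assms(3) unfolding MD(1) by simp
qed

lemma frac_ideal_subset_cball:
  assumes "x \<in> frac_ideal \<pi> k" "m \<le> k"
  shows "frac_ideal \<pi> k \<subseteq> cball x (r powi m)"
proof -
  have "cball x (r powi k) = frac_ideal \<pi> k"
    using cball_eq_cball[of x 0] assms(1) by (simp add: frac_ideal_eq_cball)
  moreover have "r powi k \<le> r powi m" using assms(2) by (simp add: r_powi_le_iff)
  then have "cball x (r powi k) \<subseteq> cball x (r powi m)" by (rule subset_cball)
  ultimately show ?thesis by simp
qed

text \<open>The measure on the unit ball is pushed forward by multiplication by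
  \<open>\<pi> powi k\<close>. For \<open>m \<le> k\<close> the ball swallows the whole ideal, and
  truncation by \<open>nat\<close> gives exponent 0, that is mass 1.\<close>

lemma add_haar:
  shows homogeneous_add_haar: "homogeneous_measure (frac_ideal \<pi> k) (add_haar \<pi> k)"
    and measure_add_haar_cball: "x \<in> frac_ideal \<pi> k \<Longrightarrow>
      measure (add_haar \<pi> k) (cball x (r powi m)) = (1 / q) ^ nat (m - k)"
proof -
  obtain H :: "'a measure" where H: "borel_prob_on (cball 0 1) H"
    and H_cball: "\<And>x N. x \<in> cball 0 1 \<Longrightarrow> measure H (cball x (r ^ N)) = (1 / q) ^ N"
    using exists_haar_integer_ring by blast
  define T where "T = (*) (\<pi> powi k)"
  define G where "G = distr H borel T"
  have T: "dist (T x) (T y) = r powi k * dist x y" for x y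
    by (simp add: T_def dist_mult absval_powi)
  have TE: "T ` cball 0 1 = frac_ideal \<pi> k"
    using cball_0_scale[of k 0] by (simp add: T_def frac_ideal_eq_cball)
  have "frac_ideal \<pi> k \<in> sets borel"
    using compact_frac_ideal by (rule borel_compact)
  then have G: "borel_prob_on (frac_ideal \<pi> k) G"
    using borel_prob_on_distr[OF H similarity_borel(2)[OF T r_powi_pos]]
    unfolding G_def TE by blast
  have mass: "measure G (cball y (r powi m)) = (1 / q) ^ nat (m - k)" if y: "y \<in> frac_ideal \<pi> k" for y m
  proof (cases "m \<le> k")
    case True
    then show ?thesis
      using measure_eq_1_if_superset[OF G frac_ideal_subset_cball[OF y True]] by simp
  next
    case False
    obtain x where x: "x \<in> cball 0 1" "y = T x" using y unfolding TE[symmetric] by blast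
    have "measure G (cball y (r powi m)) = measure H (cball x (r powi m / r powi k))"
      unfolding G_def x(2)
      by (rule measure_distr_cball_similarity[OF T r_powi_pos borel_prob_onD(1)[OF H]])
    also have "r powi m / r powi k = r ^ nat (m - k)"
      using False by (simp add: power_int_diff[symmetric]) (simp add: power_int_def)
    finally show ?thesis using H_cball[OF x(1)] by simp
  qed
  have "homogeneous_measure (frac_ideal \<pi> k) G"
    using G mass by (rule homogeneous_measureI)
  with mass show "homogeneous_measure (frac_ideal \<pi> k) (add_haar \<pi> k)"
    "x \<in> frac_ideal \<pi> k \<Longrightarrow> measure (add_haar \<pi> k) (cball x (r powi m)) = (1 / q) ^ nat (m - k)"
    by (simp_all only: add_haar_eq)
qed

lemma unit_sphere_eq_Diff: "unit_sphere \<pi> k = cball 0 (r powi k) - cball 0 (r powi (k + 1))"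
proof -
  have "absval x = r powi k \<longleftrightarrow> absval x \<le> r powi k \<and> \<not> absval x \<le> r powi (k + 1)" for x :: 'a
    using absval_gap[of x k] by linarith
  then show ?thesis by (auto simp: unit_sphere_eq_sphere dist_zero)
qed

lemma cball_subset_unit_sphere:
  assumes "x \<in> unit_sphere \<pi> k" "k < m"
  shows "cball x (r powi m) \<subseteq> unit_sphere \<pi> k"
proof
  fix y assume y: "y \<in> cball x (r powi m)"
  have "r powi m < r powi k" using assms(2) by (simp add: r_powi_less_iff)
  then have "absval (x - (x - y)) = absval x"
    using assms(1) y
    by (intro absval_diff_eq) (simp add: unit_sphere_eq_sphere dist_zero nonarch_dist[symmetric])
  then show "y \<in> unit_sphere \<pi> k" using assms(1) by (simp add: unit_sphere_eq_sphere dist_zero)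
qed

text \<open>Additive Haar measure of the ideal, conditioned on the sphere. The sphere is the ideal
  minus the next smaller one, so it has mass \<open>1 - 1 / q\<close>, whence the factor
  \<open>q / (q - 1)\<close> for balls inside it; larger balls contain the whole sphere.\<close>

lemma mult_haar:
  shows homogeneous_mult_haar: "homogeneous_measure (unit_sphere \<pi> k) (mult_haar \<pi> k)"
    and measure_mult_haar_cball: "x \<in> unit_sphere \<pi> k \<Longrightarrow> measure (mult_haar \<pi> k) (cball x (r powi m)) =
      (if m \<le> k then 1 else real q / (real q - 1) * (1 / q) ^ nat (m - k))"
proof -
  define H where "H = add_haar \<pi> k"
  define S where "S = unit_sphere \<pi> k"
  have H: "borel_prob_on (frac_ideal \<pi> k) H"
    using homogeneous_add_haar unfolding H_def homogeneous_measure_def by blast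
  note HD = borel_prob_onD[OF H]
  interpret H: prob_space H by (rule HD)
  have q: "real q \<ge> 2" using card_residue_classes_ge_2 by simp
  have z: "0 \<in> frac_ideal \<pi> k" using r_powi_pos[of k] by (simp add: frac_ideal_eq_cball)
  have S_frac: "S \<subseteq> frac_ideal \<pi> k" by (auto simp: S_def unit_sphere_eq_sphere frac_ideal_eq_cball)
  have S_borel: "S \<in> sets borel" unfolding S_def using compact_unit_sphere by (rule borel_compact)
  have "cball 0 (r powi (k + 1)) \<subseteq> cball (0 :: 'a) (r powi k)"
    by (rule subset_cball) (simp add: r_powi_le_iff)
  then have "measure H S = measure H (cball 0 (r powi k)) - measure H (cball 0 (r powi (k + 1)))"
    unfolding S_def unit_sphere_eq_Diff by (intro H.finite_measure_Diff) (simp_all add: HD(1))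
  then have HS: "measure H S = 1 - 1 / q"
    unfolding H_def using measure_add_haar_cball[OF z] by simp
  have S0: "emeasure H S \<noteq> 0" using q by (simp add: H.emeasure_eq_measure HS ennreal_eq_0_iff field_simps)
  define G where "G = uniform_measure H S"
  have G: "borel_prob_on S G"
    unfolding borel_prob_on_def
  proof (intro conjI)
    show "sets G = sets borel" unfolding G_def sets_uniform_measure by (rule HD(1))
    show "prob_space G" unfolding G_def using S0 by (intro prob_space_uniform_measure) simp_all
    show "AE x in G. x \<in> S" unfolding G_def by (rule AE_uniform_measureI) (simp_all add: HD(1) S_borel)
  qed
  have mass: "measure G (cball x (r powi m)) =
      (if m \<le> k then 1 else real q / (real q - 1) * (1 / q) ^ nat (m - k))" if x: "x \<in> S" for x m
  proof (cases "m \<le> k")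
    case True
    have "S \<subseteq> cball x (r powi m)"
      using frac_ideal_subset_cball[of x k m] True x S_frac by blast
    then show ?thesis using measure_eq_1_if_superset[OF G] True by simp
  next
    case False
    then have "cball x (r powi m) \<subseteq> S"
      using cball_subset_unit_sphere[of x k m] x by (simp add: S_def)
    then have "measure G (cball x (r powi m)) = measure H (cball x (r powi m)) / measure H S"
      using S0 unfolding G_def by (subst measure_uniform_measure) (simp_all add: HD(1) S_borel Int_absorb1)
    also have "\<dots> = (1 / q) ^ nat (m - k) / (1 - 1 / q)"
      unfolding HS unfolding H_def using measure_add_haar_cball x S_frac by auto
    also have "\<dots> = real q / (real q - 1) * (1 / q) ^ nat (m - k)"
      using q by (simp add: field_simps)
    finally show ?thesis using False by simp
  qed
  have "homogeneous_measure S G"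
    using G mass by (rule homogeneous_measureI)
  with mass show "homogeneous_measure (unit_sphere \<pi> k) (mult_haar \<pi> k)"
    "x \<in> unit_sphere \<pi> k \<Longrightarrow> measure (mult_haar \<pi> k) (cball x (r powi m)) =
      (if m \<le> k then 1 else real q / (real q - 1) * (1 / q) ^ nat (m - k))"
    unfolding S_def by (simp_all only: mult_haar_eq)
qed

end

section \<open>The linear system\<close>

lemma sum_int_interval_uminus:
  fixes f :: "int \<Rightarrow> 'a::comm_monoid_add"
  shows "(\<Sum>k\<in>{- int N..0}. f k) = (\<Sum>j\<le>N. f (- int j))"
  by (rule sum.reindex_bij_witness[of _ "\<lambda>j. - int j" "\<lambda>k. nat (- k)"]) auto

lemma real_min_eq_sum:
  assumes "i \<le> N"
  shows "real (min i j) = (\<Sum>m<N. of_bool (m < i) * of_bool (m < j))"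
proof -
  have "{..<N} \<inter> {m. m < i \<and> m < j} = {..<min i j}" using assms by auto
  moreover have "(\<Sum>m<N. of_bool (m < i) * of_bool (m < j)) = (\<Sum>m<N. of_bool (m < i \<and> m < j) :: real)"
    by (rule sum.cong) auto
  ultimately show ?thesis by (simp add: sum_of_bool_eq)
qed

text \<open>The matrix \<open>min i j\<close> is the Gram matrix of the vectors \<open>(1, \<dots>, 1, 0, \<dots>, 0)\<close>.\<close>

lemma min_matrix_nonneg:
  fixes d :: "nat \<Rightarrow> real"
  shows "0 \<le> (\<Sum>i\<le>N. d i * (\<Sum>j\<le>N. real (min i j) * d j))"
proof -
  have "(\<Sum>i\<le>N. d i * (\<Sum>j\<le>N. real (min i j) * d j)) =
      (\<Sum>i\<le>N. \<Sum>j\<le>N. \<Sum>m<N. (of_bool (m < i) * d i) * (of_bool (m < j) * d j))"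
    unfolding sum_distrib_left
  proof (intro sum.cong refl)
    fix i j assume "i \<in> {..N}"
    then have "d i * (real (min i j) * d j) = d i * (\<Sum>m<N. of_bool (m < i) * of_bool (m < j)) * d j"
      by (subst real_min_eq_sum[of i N j]) auto
    also have "\<dots> = (\<Sum>m<N. (of_bool (m < i) * d i) * (of_bool (m < j) * d j))"
      unfolding sum_distrib_left sum_distrib_right by (intro sum.cong refl) (simp only: mult_ac)
    finally show "d i * (real (min i j) * d j) =
        (\<Sum>m<N. (of_bool (m < i) * d i) * (of_bool (m < j) * d j))" .
  qed
  also have "\<dots> = (\<Sum>i\<le>N. \<Sum>m<N. \<Sum>j\<le>N. (of_bool (m < i) * d i) * (of_bool (m < j) * d j))"
    by (intro sum.cong refl sum.swap)
  also have "\<dots> = (\<Sum>m<N. \<Sum>i\<le>N. \<Sum>j\<le>N. (of_bool (m < i) * d i) * (of_bool (m < j) * d j))"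
    by (rule sum.swap)
  also have "\<dots> = (\<Sum>m<N. (\<Sum>i\<le>N. of_bool (m < i) * d i)\<^sup>2)"
    by (simp only: power2_eq_square sum_product)
  also have "\<dots> \<ge> 0" by (intro sum_nonneg) simp
  finally show ?thesis .
qed

text \<open>Pairing the rows with \<open>d\<close> kills the unknown \<open>w\<close>, because
  \<open>d\<close> has sum 0. What remains is a nonnegative form plus a positive diagonal one, so
  \<open>d\<close> vanishes.\<close>

lemma min_matrix_plus_diagonal_kernel:
  fixes d D :: "nat \<Rightarrow> real"
  assumes D: "\<And>i. 0 < D i"
    and rows: "\<And>i. i \<le> N \<Longrightarrow> (\<Sum>j\<le>N. real (min i j) * d j) + D i * d i = w"
    and sum: "(\<Sum>j\<le>N. d j) = 0" and i: "i \<le> N"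
  shows "d i = 0"
proof -
  have "(\<Sum>i\<le>N. d i * (\<Sum>j\<le>N. real (min i j) * d j)) + (\<Sum>i\<le>N. D i * (d i)\<^sup>2) =
      (\<Sum>i\<le>N. d i * ((\<Sum>j\<le>N. real (min i j) * d j) + D i * d i))"
    unfolding sum.distrib[symmetric]
    by (rule sum.cong) (simp_all add: power2_eq_square algebra_simps)
  also have "\<dots> = (\<Sum>i\<le>N. d i * w)" by (rule sum.cong) (simp_all add: rows)
  also have "\<dots> = 0" using sum by (simp flip: sum_distrib_right)
  finally have "(\<Sum>i\<le>N. D i * (d i)\<^sup>2) \<le> 0" using min_matrix_nonneg[of d N] by linarith
  moreover have nonneg: "0 \<le> D i * (d i)\<^sup>2" for i using D[of i] by simp
  then have "0 \<le> (\<Sum>i\<le>N. D i * (d i)\<^sup>2)" by (intro sum_nonneg) simp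
  ultimately have "(\<Sum>i\<le>N. D i * (d i)\<^sup>2) = 0" by linarith
  then have "D i * (d i)\<^sup>2 = 0" using i nonneg by (subst (asm) sum_nonneg_eq_0_iff) auto
  then show ?thesis using D[of i] by simp
qed

section \<open>The system in natural indices and uniqueness of its solution\<close>

text \<open>The excess of a diagonal entry of the energy matrix over \<open>min i i\<close>, with
  the factor \<open>l\<close> removed.\<close>

definition energy_diagonal :: "real \<Rightarrow> nat \<Rightarrow> real"
  where "energy_diagonal Q i = (if i = 0 then 1 / (Q - 1) else Q / (Q - 1)\<^sup>2)"

lemma energy_matrix_uminus:
  "energy_matrix l q (- int i) (- int j) =
    l * (real (min i j) + (if i = j then energy_diagonal q i else 0))"
  by (auto simp: energy_matrix_def energy_diagonal_def min_def)

lemma equilibrium_system_uminus: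
  "equilibrium_system l q (- int N) c v \<longleftrightarrow>
    (\<forall>i\<le>N. l * ((\<Sum>j\<le>N. real (min i j) * c (- int j)) + energy_diagonal q i * c (- int i)) = v) \<and>
    (\<Sum>j\<le>N. c (- int j)) = 1"
proof -
  have "(\<Sum>j\<in>{- int N..0}. energy_matrix l q (- int i) j * c j) =
      l * ((\<Sum>j\<le>N. real (min i j) * c (- int j)) + energy_diagonal q i * c (- int i))" if "i \<le> N" for i
  proof -
    have "(\<Sum>j\<in>{- int N..0}. energy_matrix l q (- int i) j * c j) =
        (\<Sum>j\<le>N. l * (real (min i j) * c (- int j)) +
          (if i = j then l * (energy_diagonal q i * c (- int i)) else 0))"
      unfolding sum_int_interval_uminus energy_matrix_uminus
      by (rule sum.cong) (simp_all add: algebra_simps)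
    also have "\<dots> = l * ((\<Sum>j\<le>N. real (min i j) * c (- int j)) + energy_diagonal q i * c (- int i))"
      using that by (simp add: sum.distrib sum_distrib_left distrib_left)
    finally show ?thesis .
  qed
  moreover have "(\<forall>i\<in>{- int N..0}. P i) \<longleftrightarrow> (\<forall>i\<le>N. P (- int i))" for P
  proof
    assume P: "\<forall>i\<le>N. P (- int i)"
    show "\<forall>i\<in>{- int N..0}. P i"
    proof
      fix i assume "i \<in> {- int N..0}"
      then have "nat (- i) \<le> N" "i = - int (nat (- i))" by auto
      with P show "P i" by metis
    qed
  qed auto
  ultimately show ?thesis
    unfolding equilibrium_system_def sum_int_interval_uminus by simp
qed

lemma energy_diagonal_pos: "Q > 1 \<Longrightarrow> 0 < energy_diagonal Q i"
  by (simp add: energy_diagonal_def)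

lemma equilibrium_system_unique:
  assumes "l > 0" "q \<ge> 2" and c: "equilibrium_system l q (- int N) c v"
    and c': "equilibrium_system l q (- int N) c' v'"
  shows "v' = v" "\<And>k. k \<in> {- int N..0} \<Longrightarrow> c' k = c k"
proof -
  define d where "d i = c' (- int i) - c (- int i)" for i
  have rows: "(\<Sum>j\<le>N. real (min i j) * d j) + energy_diagonal q i * d i = (v' - v) / l" if "i \<le> N" for i
  proof -
    let ?R = "\<lambda>c. (\<Sum>j\<le>N. real (min i j) * c (- int j)) + energy_diagonal q i * c (- int i)"
    have R: "l * ?R c' = v'" "l * ?R c = v" using c c' that unfolding equilibrium_system_uminus by blast+
    have "(\<Sum>j\<le>N. real (min i j) * d j) + energy_diagonal q i * d i = ?R c' - ?R c"
      by (simp add: d_def right_diff_distrib sum_subtractf)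
    then have "((\<Sum>j\<le>N. real (min i j) * d j) + energy_diagonal q i * d i) * l = v' - v"
      unfolding R[symmetric] by (simp only: mult.commute[of _ l] right_diff_distrib)
    then show ?thesis using \<open>l > 0\<close> by (metis nonzero_eq_divide_eq less_irrefl)
  qed
  have "(\<Sum>j\<le>N. d j) = 0"
    using c c' by (simp add: equilibrium_system_uminus d_def sum_subtractf)
  then have d0: "d i = 0" if "i \<le> N" for i
    using min_matrix_plus_diagonal_kernel[of "energy_diagonal q" N d "(v' - v) / l" i]
      energy_diagonal_pos rows that \<open>q \<ge> 2\<close> by simp
  then have "(v' - v) / l = 0" using rows[of 0] by simp
  then show "v' = v" using \<open>l > 0\<close> by simp
  fix k assume "k \<in> {- int N..0}"
  then have "nat (- k) \<le> N" "k = - int (nat (- k))" by auto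
  then show "c' k = c k" using d0[of "nat (- k)"] by (simp add: d_def)
qed

section \<open>Closed form of the solution\<close>

text \<open>
  Subtracting consecutive rows of the system gives \<open>T (i + 2) - (Q + 1 / Q) * T (i + 1) + T i = 0\<close>
  for the tails \<open>T i = c i + \<dots> + c N\<close>; the solution vanishing at \<open>i = N + 1\<close> is proportional to
  \<open>Q ^ (1 - i) - Q ^ (i - 1 - 2 * N)\<close>.
\<close>

definition coefficient_tail :: "real \<Rightarrow> nat \<Rightarrow> nat \<Rightarrow> real"
  where "coefficient_tail Q N i = ((1 / Q) ^ (i - 1) - (1 / Q) ^ (2 * N) * Q ^ (i - 1)) / (Q + 1)"

text \<open>A difference of consecutive tails for \<open>i > 0\<close>, and for \<open>i = 0\<close>
  the mass left over. The case split is needed because \<open>i - 1\<close> is truncated at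
  \<open>i = 0\<close>. The normalisation \<open>1 / (Q + 1)\<close> of the tails results from
  equating rows 0 and 1 under total mass 1.\<close>

definition coefficient :: "real \<Rightarrow> nat \<Rightarrow> nat \<Rightarrow> real"
  where "coefficient Q N i = (if i = 0 then (Q + (1 / Q) ^ (2 * N)) / (Q + 1)
    else (Q - 1) / (Q + 1) * ((1 / Q) ^ i + (1 / Q) ^ (2 * N) * Q ^ (i - 1)))"

lemma coefficient_nonneg: "Q > 1 \<Longrightarrow> 0 \<le> coefficient Q N i"
  by (simp add: coefficient_def)

lemma coefficient_eq_diff:
  assumes "Q > 1" "i > 0"
  shows "coefficient Q N i = coefficient_tail Q N i - coefficient_tail Q N (Suc i)"
proof -
  obtain m where "i = Suc m" using \<open>i > 0\<close> gr0_implies_Suc by blast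
  then show ?thesis
    using \<open>Q > 1\<close> by (simp add: coefficient_def coefficient_tail_def divide_simps) (simp add: algebra_simps)
qed

lemma sum_coefficient_tail:
  assumes "Q > 1" "0 < i" "i \<le> Suc N"
  shows "(\<Sum>j=i..N. coefficient Q N j) = coefficient_tail Q N i"
proof -
  have "coefficient_tail Q N (Suc N) = 0"
    using \<open>Q > 1\<close> by (simp add: coefficient_tail_def mult_2 power_add power_divide)
  moreover have "(\<Sum>j=i..N. coefficient Q N j) = (\<Sum>j=i..N. coefficient_tail Q N j - coefficient_tail Q N (Suc j))"
    using assms by (intro sum.cong) (auto simp: coefficient_eq_diff)
  ultimately show ?thesis
    using sum_Suc_diff[OF \<open>i \<le> Suc N\<close>, of "\<lambda>j. - coefficient_tail Q N j"] by (simp add: algebra_simps)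
qed

lemma sum_coefficient:
  assumes "Q > 1"
  shows "(\<Sum>j\<le>N. coefficient Q N j) = 1"
proof -
  have "(\<Sum>j\<le>N. coefficient Q N j) = coefficient Q N 0 + coefficient_tail Q N 1"
    using sum_coefficient_tail[OF assms, of 1 N]
    by (simp add: atMost_atLeast0 sum.atLeast_Suc_atMost)
  also have "\<dots> = 1"
    using assms by (simp add: coefficient_def coefficient_tail_def add_divide_distrib[symmetric])
  finally show ?thesis .
qed

text \<open>Passing from \<open>i\<close> to \<open>Suc i\<close> raises \<open>min i j\<close> by
  one exactly for \<open>j > i\<close>, which adds the tail starting at
  \<open>Suc i\<close>.\<close>

lemma sum_min_coefficient:
  assumes "Q > 1" "i \<le> N"
  shows "(\<Sum>j\<le>N. real (min i j) * coefficient Q N j) = (\<Sum>m<i. coefficient_tail Q N (Suc m))"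
  using assms(2)
proof (induction i)
  case (Suc i)
  have "(\<Sum>j\<le>N. real (min (Suc i) j) * coefficient Q N j) =
      (\<Sum>j\<le>N. real (min i j) * coefficient Q N j + (if Suc i \<le> j then coefficient Q N j else 0))"
    by (rule sum.cong) (auto simp: min_def algebra_simps not_less_eq_eq)
  also have "\<dots> = (\<Sum>m<i. coefficient_tail Q N (Suc m)) + (\<Sum>j\<in>{..N} \<inter> {j. Suc i \<le> j}. coefficient Q N j)"
    using Suc by (simp add: sum.distrib sum.If_cases)
  also have "{..N} \<inter> {j. Suc i \<le> j} = {Suc i..N}" by auto
  also have "(\<Sum>j=Suc i..N. coefficient Q N j) = coefficient_tail Q N (Suc i)"
    using Suc.prems assms(1) by (intro sum_coefficient_tail) auto
  finally show ?case by simp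
qed simp

text \<open>All rows agree. The value is that of row 0, \<open>coefficient Q N 0 / (Q - 1)\<close>;
  from row 1 on the diagonal entry is constant, and induction applies.\<close>

lemma sum_coefficient_tail_plus_diagonal:
  assumes "Q > 1"
  shows "(\<Sum>m<i. coefficient_tail Q N (Suc m)) + energy_diagonal Q i * coefficient Q N i =
    (Q + (1 / Q) ^ (2 * N)) / (Q\<^sup>2 - 1)"
proof -
  have Q2: "Q\<^sup>2 - 1 = (Q - 1) * (Q + 1)" by (simp add: power2_eq_square algebra_simps)
  show ?thesis
  proof (cases i)
    case 0
    then show ?thesis using assms by (simp add: Q2 energy_diagonal_def coefficient_def)
  next
    case (Suc m)
    have "(\<Sum>m<Suc m. coefficient_tail Q N (Suc m)) + Q / (Q - 1)\<^sup>2 * coefficient Q N (Suc m) =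
      (Q + (1 / Q) ^ (2 * N)) / (Q\<^sup>2 - 1)"
    proof (induction m)
      case 0
      show ?case
        using assms unfolding Q2
        by (simp add: coefficient_def coefficient_tail_def power2_eq_square divide_simps)
          (simp add: algebra_simps)
    next
      case (Suc m)
      \<comment> \<open>The difference of two consecutive rows, equivalent to the recurrence for the
        tails.\<close>
      have "coefficient_tail Q N (Suc (Suc m)) +
          Q / (Q - 1)\<^sup>2 * (coefficient Q N (Suc (Suc m)) - coefficient Q N (Suc m)) = 0"
        using assms
        by (simp add: coefficient_def coefficient_tail_def power2_eq_square divide_simps)
          (simp add: algebra_simps)
      then show ?case using Suc by (simp add: algebra_simps)
    qed
    then show ?thesis by (simp only: Suc energy_diagonal_def if_False nat.distinct)
  qed
qed

lemma equilibrium_system_coefficient: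
  assumes "q \<ge> 2"
  shows "equilibrium_system l q (- int N) (\<lambda>k. coefficient q N (nat (- k)))
    (l * ((real q + (1 / q) ^ (2 * N)) / ((real q)\<^sup>2 - 1)))"
  using assms unfolding equilibrium_system_uminus
  by (simp add: sum_min_coefficient sum_coefficient_tail_plus_diagonal sum_coefficient)

section \<open>Potentials\<close>

context uniformized_local_field
begin

text \<open>The denominators of the spherical metric are at least 1 on affine points, so the
  embedding is 1-Lipschitz.\<close>

lemma continuous_affine_point: "continuous_on UNIV (affine_point :: 'a \<Rightarrow> _)"
proof (rule continuous_on_iff[THEN iffD2], intro ballI allI impI)
  fix x :: 'a and e :: real assume "0 < e"
  have "dist (affine_point y) (affine_point x) \<le> dist y x" for y
  proof -
    have "1 * 1 \<le> max 1 (absval y) * max 1 (absval x)" by (intro mult_mono) auto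
    then have "absval (y - x) / (max 1 (absval y) * max 1 (absval x)) \<le> absval (y - x) / 1"
      by (intro divide_left_mono) (auto simp: nonarch_absval_nonneg)
    then show ?thesis by (simp add: dist_proj_line_def sphere_dist_affine_point nonarch_dist)
  qed
  then show "\<exists>d>0. \<forall>y\<in>UNIV. dist y x < d \<longrightarrow> dist (affine_point y) (affine_point x) < e"
    using \<open>0 < e\<close> order.strict_trans1 by blast
qed

lemma affine_point_borel: "(affine_point :: 'a \<Rightarrow> _) \<in> borel_measurable borel"
  using continuous_affine_point by (rule borel_measurable_continuous_onI)

lemma compact_affine_image: "compact (E :: 'a set) \<Longrightarrow> compact (affine_point ` E)"
  using compact_continuous_image continuous_on_subset[OF continuous_affine_point] by blast

lemma borel_prob_on_to_proj:
  assumes "compact (E :: 'a set)" "borel_prob_on E M"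
  shows "borel_prob_on (affine_point ` E) (to_proj M)"
  unfolding to_proj_def using assms(2) affine_point_borel
  by (rule borel_prob_on_distr) (rule borel_compact[OF compact_affine_image[OF assms(1)]])

section \<open>Potentials of the Haar measures, computed in the field\<close>

text \<open>The affine part of a ball of the projective line, so that masses can be found before
  measures are pushed forward.\<close>

definition spherical_ball :: "'a \<Rightarrow> nat \<Rightarrow> 'a set"
  where "spherical_ball y k = {x. sphere_dist (affine_point x) (affine_point y) \<le> r ^ Suc k}"

lemma spherical_ball_borel: "spherical_ball y k \<in> sets borel"
proof -
  have "spherical_ball y k = affine_point -` cball (affine_point y) (r ^ Suc k)"
    by (auto simp: spherical_ball_def dist_proj_line_def sphere_dist_commute)
  moreover have "closed (cball (affine_point y) (r ^ Suc k))" by simp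
  ultimately show ?thesis
    using continuous_closed_vimage[of _ affine_point] continuous_affine_point
    by (metis borel_closed closed_vimage)
qed

text \<open>The layered form of the potential of \<open>to_proj M\<close> at an affine point, as
  \<open>nn_integral_neg_log_dist_to_proj\<close> confirms.\<close>

definition potential :: "'a measure \<Rightarrow> 'a \<Rightarrow> ennreal"
  where "potential M y = (\<Sum>k. ennreal (- ln r) * emeasure M (spherical_ball y k))"

lemma nn_integral_neg_log_dist_to_proj:
  assumes "sets M = sets borel"
  shows "(\<integral>\<^sup>+ x. neg_log_dist x (affine_point y) \<partial>to_proj M) = potential M y"
proof -
  have "sets (to_proj M) = sets borel" by (simp add: to_proj_def)
  moreover have "emeasure (to_proj M) (cball (affine_point y) (r ^ Suc k)) =
      emeasure M (spherical_ball y k)" for k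
  proof -
    have "affine_point \<in> borel_measurable M"
      using affine_point_borel by (simp only: measurable_cong_sets[OF assms refl])
    moreover have "affine_point -` cball (affine_point y) (r ^ Suc k) = spherical_ball y k"
      by (auto simp: spherical_ball_def dist_proj_line_def sphere_dist_commute)
    ultimately show ?thesis
      unfolding to_proj_def using sets_eq_imp_space_eq[OF assms]
      by (subst emeasure_distr) (simp_all add: borel_closed)
  qed
  ultimately show ?thesis unfolding potential_def by (simp only: nn_integral_neg_log_dist)
qed

lemma q_ge_2: "real q \<ge> 2"
  using card_residue_classes_ge_2 by simp

text \<open>All potentials needed have this shape: \<open>m\<close> layers of full mass, then
  geometric decay with total \<open>a / (q - 1)\<close>. The factor \<open>a\<close> is 1 for
  ideals, \<open>q / (q - 1)\<close> for a sphere seen from itself, and 0 for a component seen from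
  another piece.\<close>

lemma potential_profile:
  assumes M: "prob_space M" and a: "a \<ge> 0"
    and prof: "\<And>k. measure M (spherical_ball y k) = (if k < m then 1 else a * (1 / q) ^ (Suc k - m))"
  shows "potential M y = ennreal (- ln r * (real m + a / (real q - 1)))"
proof -
  interpret prob_space M by (rule M)
  define f where "f k = - ln r * (if k < m then 1 else a * (1 / real q) ^ (Suc k - m))" for k
  \<comment> \<open>The part from index \<open>m\<close> on; its first exponent is 1, not 0, whence
    the extra division by \<open>q\<close>.\<close>
  have "(\<lambda>k. (- ln r * a / q) * (1 / real q) ^ k) sums ((- ln r * a / q) * (1 / (1 - 1 / real q)))"
    using q_ge_2 by (intro sums_mult geometric_sums) simp
  moreover have "(- ln r * a / q) * (1 / real q) ^ k = f (k + m)" for k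
    by (simp add: f_def)
  moreover have "(- ln r * a / q) * (1 / (1 - 1 / real q)) = - ln r * (a / (real q - 1))"
    using q_ge_2 by (simp add: field_simps)
  ultimately have "(\<lambda>k. f (k + m)) sums (- ln r * (a / (real q - 1)))" by (simp only:)
  then have "f sums (- ln r * (a / (real q - 1)) + (\<Sum>k<m. f k))"
    by (rule sums_iff_shift[THEN iffD1])
  moreover have "(\<Sum>k<m. f k) = - ln r * real m" by (simp add: f_def)
  ultimately have sums: "f sums (- ln r * (real m + a / (real q - 1)))"
    by (simp add: algebra_simps)
  have nonneg: "0 \<le> f k" for k using ln_r_neg a by (auto simp: f_def mult_nonpos_nonneg)
  have "ennreal (- ln r) * emeasure M (spherical_ball y k) = ennreal (f k)" for k
    unfolding emeasure_eq_measure prof f_def using ln_r_neg a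
    by (intro ennreal_mult[symmetric]) auto
  then show ?thesis
    unfolding potential_def using suminf_ennreal_eq[OF nonneg sums] by simp
qed

lemma measure_spherical_ball_eq:
  assumes M: "borel_prob_on E M"
    and iff: "\<And>x. x \<in> E \<Longrightarrow> sphere_dist (affine_point x) (affine_point y) \<le> r ^ Suc k \<longleftrightarrow> x \<in> A"
    and A: "A \<in> sets borel"
  shows "measure M (spherical_ball y k) = measure M A"
proof -
  note MD = borel_prob_onD[OF M]
  show ?thesis
  proof (rule measure_eq_AE)
    show "AE x in M. x \<in> spherical_ball y k \<longleftrightarrow> x \<in> A"
      using MD(3) by (rule eventually_mono) (simp only: spherical_ball_def mem_Collect_eq iff)
  qed (simp_all only: MD(1) A spherical_ball_borel)
qed

text \<open>On elements of absolute value at most 1 the spherical metric is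
  \<open>absval (x - y)\<close>, so spherical balls are ordinary ones.\<close>

lemma potential_add_haar:
  assumes y: "y \<in> frac_ideal \<pi> (int n)"
  shows "potential (add_haar \<pi> (int n)) y = ennreal (- ln r * (real n + 1 / (real q - 1)))"
proof (rule potential_profile)
  have M: "borel_prob_on (frac_ideal \<pi> (int n)) (add_haar \<pi> (int n))"
    using homogeneous_add_haar unfolding homogeneous_measure_def by blast
  then show "prob_space (add_haar \<pi> (int n))" by (rule borel_prob_onD)
  fix k
  have le1: "absval x \<le> 1" if "x \<in> frac_ideal \<pi> (int n)" for x
  proof -
    have "r powi int n \<le> r powi 0" unfolding r_powi_le_iff by simp
    then show ?thesis using that by (simp add: frac_ideal_eq_cball dist_zero)
  qed
  have "measure (add_haar \<pi> (int n)) (spherical_ball y k) =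
      measure (add_haar \<pi> (int n)) (cball y (r powi int (Suc k)))"
  proof (rule measure_spherical_ball_eq[OF M])
    fix x assume "x \<in> frac_ideal \<pi> (int n)"
    then show "sphere_dist (affine_point x) (affine_point y) \<le> r ^ Suc k \<longleftrightarrow>
        x \<in> cball y (r powi int (Suc k))"
      unfolding power_int_of_nat
      using le1 le1[OF y] by (simp add: sphere_dist_affine_point max_absorb1 dist_commute[of y] flip: nonarch_dist)
  qed simp
  also have "\<dots> = (1 / q) ^ nat (int (Suc k) - int n)"
    by (rule measure_add_haar_cball[OF y])
  also have "\<dots> = (if k < n then 1 else 1 * (1 / q) ^ (Suc k - n))"
    by (simp add: nat_diff_distrib' del: of_nat_Suc)
  finally show "measure (add_haar \<pi> (int n)) (spherical_ball y k) =
      (if k < n then 1 else 1 * (1 / q) ^ (Suc k - n))" .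
qed simp

text \<open>On the sphere of radius \<open>R = r powi (- int j)\<close> the spherical metric is
  \<open>absval (x - y) / R\<^sup>2\<close>. Spherical radius \<open>r ^ Suc k\<close> thus becomes
  exponent \<open>Suc k - 2 * j\<close>, and the ball contains the sphere exactly when
  \<open>k < j\<close>.\<close>

lemma potential_mult_haar:
  assumes y: "y \<in> unit_sphere \<pi> (- int j)"
  shows "potential (mult_haar \<pi> (- int j)) y =
    ennreal (- ln r * (real j + real q / (real q - 1)\<^sup>2))"
proof -
  define a where "a = real q / (real q - 1)"
  have M: "borel_prob_on (unit_sphere \<pi> (- int j)) (mult_haar \<pi> (- int j))"
    using homogeneous_mult_haar unfolding homogeneous_measure_def by blast
  have "potential (mult_haar \<pi> (- int j)) y = ennreal (- ln r * (real j + a / (real q - 1)))"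
  proof (rule potential_profile)
    show "prob_space (mult_haar \<pi> (- int j))" using M by (rule borel_prob_onD)
    show "0 \<le> a" using q_ge_2 by (simp add: a_def)
    fix k
    have "measure (mult_haar \<pi> (- int j)) (spherical_ball y k) =
        measure (mult_haar \<pi> (- int j)) (cball y (r powi (int (Suc k) - 2 * int j)))"
    proof (rule measure_spherical_ball_eq[OF M])
      fix x assume x: "x \<in> unit_sphere \<pi> (- int j)"
      define R where "R = r powi (- int j)"
      have R: "absval x = R" "absval y = R"
        using x y by (simp_all add: R_def unit_sphere_eq_sphere dist_zero)
      have "r powi 0 \<le> R" unfolding R_def r_powi_le_iff by simp
      then have "1 \<le> R" by simp
      then have "sphere_dist (affine_point x) (affine_point y) = absval (x - y) / R\<^sup>2"
        by (simp add: sphere_dist_affine_point R power2_eq_square)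
      also have "\<dots> \<le> r ^ Suc k \<longleftrightarrow> absval (x - y) \<le> r ^ Suc k * R\<^sup>2"
        using \<open>1 \<le> R\<close> by (simp add: divide_le_eq)
      also have "r ^ Suc k * R\<^sup>2 = r powi (int (Suc k) + - int j + - int j)"
        by (simp only: R_def power2_eq_square power_int_add[OF disjI1[OF r_nonzero]] power_int_of_nat mult.assoc)
      also have "int (Suc k) + - int j + - int j = int (Suc k) - 2 * int j" by simp
      finally show "sphere_dist (affine_point x) (affine_point y) \<le> r ^ Suc k \<longleftrightarrow>
          x \<in> cball y (r powi (int (Suc k) - 2 * int j))"
        by (simp add: dist_commute[of y] flip: nonarch_dist)
    qed simp
    also have "\<dots> = (if int (Suc k) - 2 * int j \<le> - int j then 1
        else a * (1 / q) ^ nat (int (Suc k) - 2 * int j - - int j))"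
      unfolding measure_mult_haar_cball[OF y] a_def by simp
    also have "int (Suc k) - 2 * int j \<le> - int j \<longleftrightarrow> k < j" by auto
    also have "int (Suc k) - 2 * int j - - int j = int (Suc k) - int j" by simp
    also have "nat (int (Suc k) - int j) = Suc k - j" by simp
    finally show "measure (mult_haar \<pi> (- int j)) (spherical_ball y k) =
        (if k < j then 1 else a * (1 / q) ^ (Suc k - j))" .
  qed
  then show ?thesis by (simp add: a_def power2_eq_square)
qed

section \<open>Pieces of an ideal and their mutual energies\<close>

text \<open>The carrier of \<open>component \<pi> k\<close>; index 0 stands for the whole integer
  ring, not for its unit sphere.\<close>

definition piece :: "int \<Rightarrow> 'a set"
  where "piece k = (if k = 0 then frac_ideal \<pi> 0 else unit_sphere \<pi> k)"

lemma borel_prob_on_component: "borel_prob_on (piece k) (component \<pi> k)"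
  using homogeneous_add_haar homogeneous_mult_haar
  by (simp add: piece_def component_def homogeneous_measure_def)

lemma frac_ideal_eq_Union_pieces:
  assumes "n \<le> 0"
  shows "frac_ideal \<pi> n = (\<Union>k\<in>{n..0}. piece k)"
proof (intro equalityI subsetI)
  fix x assume x: "x \<in> frac_ideal \<pi> n"
  show "x \<in> (\<Union>k\<in>{n..0}. piece k)"
  proof (cases "absval x \<le> 1")
    case True
    then show ?thesis
      using assms by (auto simp: piece_def frac_ideal_eq_cball dist_zero intro!: bexI[of _ 0])
  next
    case False
    then have "x \<noteq> 0" by auto
    then obtain k where k: "absval x = r powi k" by (rule absval_eq_powi)
    then have "\<not> r powi k \<le> r powi 0" "r powi k \<le> r powi n"
      using False x by (simp_all add: frac_ideal_eq_cball dist_zero)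
    then have "n \<le> k" "k < 0" unfolding r_powi_le_iff by simp_all
    then show ?thesis
      using k by (auto simp: piece_def unit_sphere_eq_sphere dist_zero intro!: bexI[of _ k])
  qed
next
  fix x assume "x \<in> (\<Union>k\<in>{n..0}. piece k)"
  then obtain k where "n \<le> k" "x \<in> piece k" by auto
  moreover have "r powi k \<le> r powi n" "r powi 0 \<le> r powi n"
    using assms \<open>n \<le> k\<close> unfolding r_powi_le_iff by simp_all
  ultimately show "x \<in> frac_ideal \<pi> n"
    by (auto simp: piece_def unit_sphere_eq_sphere frac_ideal_eq_cball dist_zero split: if_splits)
qed

lemma absval_piece:
  assumes "x \<in> piece i"
  shows "absval x \<le> r powi i" "i < 0 \<Longrightarrow> absval x = r powi i" "i \<le> 0 \<Longrightarrow> max 1 (absval x) = r powi i"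
proof -
  show le: "absval x \<le> r powi i" and eq: "i < 0 \<Longrightarrow> absval x = r powi i"
    using assms by (auto simp: piece_def unit_sphere_eq_sphere frac_ideal_eq_cball dist_zero split: if_splits)
  assume "i \<le> 0"
  show "max 1 (absval x) = r powi i"
  proof (cases "i = 0")
    case False
    have "r powi 0 \<le> r powi i" unfolding r_powi_le_iff using \<open>i \<le> 0\<close> .
    then show ?thesis using eq False \<open>i \<le> 0\<close> by simp
  qed (use le in simp)
qed

text \<open>The larger value \<open>absval x\<close> equals both \<open>absval (x - y)\<close> and
  one factor of the denominator; only the factor of \<open>y\<close> survives, which is 1 on the
  integer ring.\<close>

lemma sphere_dist_different_pieces:
  assumes "x \<in> piece i" "y \<in> piece j" "i < j" "j \<le> 0"
  shows "sphere_dist (affine_point x) (affine_point y) = r powi (- j)"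
proof -
  have x: "absval x = r powi i" using absval_piece(2)[OF assms(1)] assms by simp
  have "r powi j < r powi i" using \<open>i < j\<close> by (simp add: r_powi_less_iff)
  then have "absval y < absval x" using absval_piece(1)[OF assms(2)] x by simp
  then have "absval (x - y) = r powi i" using absval_diff_eq[of y x] x by simp
  then have "sphere_dist (affine_point x) (affine_point y) = r powi i / (r powi i * r powi j)"
    using absval_piece(3)[OF assms(1)] absval_piece(3)[OF assms(2)] assms
    by (simp add: sphere_dist_affine_point)
  then show ?thesis using r_powi_pos[of i] by (simp add: power_int_minus field_simps)
qed

lemma potential_component:
  assumes y: "y \<in> piece i" and "i \<le> 0" "j \<le> 0"
  shows "potential (component \<pi> j) y = ennreal (energy_matrix (- ln r) q i j)"
proof (cases "i = j")
  case True
  show ?thesis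
  proof (cases "i = 0")
    case True
    then show ?thesis
      using potential_add_haar[of y 0] y \<open>i = j\<close> by (simp add: piece_def component_def energy_matrix_def)
  next
    case False
    obtain N where "i = - int N" using \<open>i \<le> 0\<close> nonpos_int_cases by blast
    then show ?thesis
      using potential_mult_haar[of y N] y \<open>i = j\<close> False
      by (simp add: piece_def component_def energy_matrix_def)
  qed
next
  case False
  define m where "m = nat (min (- i) (- j))"
  have m: "int m = min (- i) (- j)" using assms by (simp add: m_def)
  note M = borel_prob_on_component[of j]
  have dist: "sphere_dist (affine_point x) (affine_point y) = r ^ m" if "x \<in> piece j" for x
  proof -
    have "sphere_dist (affine_point x) (affine_point y) = r powi int m"
    proof (cases "i < j")
      case True
      then show ?thesis
        using sphere_dist_different_pieces[OF y that] assms m by (simp add: sphere_dist_commute)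
    next
      case F: False
      then show ?thesis
        using sphere_dist_different_pieces[OF that y] assms m False by simp
    qed
    then show ?thesis by simp
  qed
  \<comment> \<open>Seen from another piece, the whole component lies at the single distance
    \<open>r ^ m\<close>, so each spherical ball has mass 1 or 0.\<close>
  have "potential (component \<pi> j) y = ennreal (- ln r * (real m + 0 / (real q - 1)))"
  proof (rule potential_profile)
    show "prob_space (component \<pi> j)" using M by (rule borel_prob_onD)
    fix k
    have "measure (component \<pi> j) (spherical_ball y k) =
        measure (component \<pi> j) (if k < m then UNIV else {})"
    proof (rule measure_spherical_ball_eq[OF M])
      fix x assume "x \<in> piece j"
      have "r powi int m \<le> r powi int (Suc k) \<longleftrightarrow> k < m" unfolding r_powi_le_iff by auto
      then have "r ^ m \<le> r ^ Suc k \<longleftrightarrow> k < m" by (simp only: power_int_of_nat)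
      then show "sphere_dist (affine_point x) (affine_point y) \<le> r ^ Suc k \<longleftrightarrow>
          x \<in> (if k < m then UNIV else {})"
        unfolding dist[OF \<open>x \<in> piece j\<close>] by simp
    qed simp
    then show "measure (component \<pi> j) (spherical_ball y k) =
        (if k < m then 1 else 0 * (1 / q) ^ (Suc k - m))"
      using measure_eq_1_if_superset[OF M, of UNIV] by simp
  qed simp
  also have "real m = real_of_int (min (- i) (- j))" by (simp only: m[symmetric] of_int_of_nat_eq)
  finally show ?thesis using False by (simp add: energy_matrix_def)
qed

end

section \<open>Finite combinations of measures and their potentials\<close>

text \<open>\<open>measure_of\<close> returns the prescribed values only once they are known to be
  countably additive; this is an exchange of a finite sum with a series.\<close>

lemma emeasure_lincomb_measure:
  assumes "finite I" "\<And>k. k \<in> I \<Longrightarrow> sets (M k) = sets borel" "A \<in> sets borel"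
  shows "emeasure (lincomb_measure I c M) A = (\<Sum>k\<in>I. ennreal (c k) * emeasure (M k) A)"
  unfolding lincomb_measure_def
proof (rule emeasure_measure_of_sigma)
  show "sigma_algebra UNIV (sets borel)" using sets.sigma_algebra_axioms[of borel] by simp
  show "positive (sets borel) (\<lambda>A. \<Sum>k\<in>I. ennreal (c k) * emeasure (M k) A)"
    by (simp add: positive_def)
  show "countably_additive (sets borel) (\<lambda>A. \<Sum>k\<in>I. ennreal (c k) * emeasure (M k) A)"
  proof (rule countably_additiveI)
    fix A :: "nat \<Rightarrow> 'b set"
    assume A: "range A \<subseteq> sets borel" "disjoint_family A"
    have "(\<Sum>i. \<Sum>k\<in>I. ennreal (c k) * emeasure (M k) (A i)) =
        (\<Sum>k\<in>I. \<Sum>i. ennreal (c k) * emeasure (M k) (A i))"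
      by (rule suminf_sum) (rule summableI)
    also have "\<dots> = (\<Sum>k\<in>I. ennreal (c k) * emeasure (M k) (\<Union>(range A)))"
      using A assms(2) by (intro sum.cong refl) (simp add: suminf_emeasure)
    finally show "(\<Sum>i. \<Sum>k\<in>I. ennreal (c k) * emeasure (M k) (A i)) =
        (\<Sum>k\<in>I. ennreal (c k) * emeasure (M k) (\<Union>(range A)))" .
  qed
qed (rule assms)

lemma sets_lincomb_measure: "sets (lincomb_measure I c M) = sets borel"
  unfolding lincomb_measure_def using sets.space_closed[of borel]
  by (simp add: sets_measure_of sets.sigma_sets_eq[of borel, simplified])

lemma borel_prob_on_lincomb_measure:
  assumes I: "finite I" and M: "\<And>k. k \<in> I \<Longrightarrow> borel_prob_on (P k) (M k)"
    and c: "\<And>k. k \<in> I \<Longrightarrow> c k \<ge> 0" "(\<Sum>k\<in>I. c k) = 1"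
    and E: "E = (\<Union>k\<in>I. P k)" "E \<in> sets borel"
  shows "borel_prob_on E (lincomb_measure I c M)"
proof -
  note MD = borel_prob_onD[OF M]
  note em = emeasure_lincomb_measure[of I M _ c, OF I MD(1)]
  have sp: "space (lincomb_measure I c M) = UNIV"
    using sets_eq_imp_space_eq[OF sets_lincomb_measure] by simp
  have "emeasure (M k) UNIV = 1" if "k \<in> I" for k
    using prob_space.emeasure_space_1[OF MD(2)[OF that]] MD(5)[OF that] by simp
  then have "emeasure (lincomb_measure I c M) UNIV = (\<Sum>k\<in>I. ennreal (c k))"
    by (simp add: em)
  also have "\<dots> = 1" using c by (simp add: sum_ennreal)
  finally have "prob_space (lincomb_measure I c M)" by (intro prob_spaceI) (simp add: sp)
  moreover have "AE x in lincomb_measure I c M. x \<in> E"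
  proof (rule AE_I')
    have "emeasure (M k) (- E) = 0" if "k \<in> I" for k
    proof -
      have "AE x in M k. x \<notin> - E"
        using MD(3)[OF that] by (rule eventually_mono) (use that E(1) in blast)
      then show ?thesis
        using AE_iff_measurable[of "- E" "M k" "\<lambda>x. x \<notin> - E"] E(2) MD(1,5)[OF that] by auto
    qed
    then have "emeasure (lincomb_measure I c M) (- E) = 0" using E(2) by (simp add: em)
    then show "- E \<in> null_sets (lincomb_measure I c M)"
      using E(2) by (auto simp: null_sets_def sets_lincomb_measure)
  qed (auto simp: sp)
  ultimately show ?thesis by (simp add: borel_prob_on_def sets_lincomb_measure)
qed

context uniformized_local_field
begin

lemma potential_lincomb_measure:
  assumes "finite I" "\<And>k. k \<in> I \<Longrightarrow> sets (M k) = sets borel"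
  shows "potential (lincomb_measure I c M) y = (\<Sum>k\<in>I. ennreal (c k) * potential (M k) y)"
proof -
  have "emeasure (lincomb_measure I c M) (spherical_ball y i) =
      (\<Sum>k\<in>I. ennreal (c k) * emeasure (M k) (spherical_ball y i))" for i
    by (rule emeasure_lincomb_measure[OF assms spherical_ball_borel])
  then have "potential (lincomb_measure I c M) y =
      (\<Sum>i. \<Sum>k\<in>I. ennreal (c k) * (ennreal (- ln r) * emeasure (M k) (spherical_ball y i)))"
    by (simp only: potential_def sum_distrib_left mult.left_commute)
  also have "\<dots> = (\<Sum>k\<in>I. \<Sum>i. ennreal (c k) * (ennreal (- ln r) * emeasure (M k) (spherical_ball y i)))"
    by (rule suminf_sum) (rule summableI)
  finally show ?thesis by (simp only: ennreal_suminf_cmult potential_def)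
qed

theorem equilibrium_to_proj:
  assumes E: "compact (E :: 'a set)" and M: "borel_prob_on E M"
    and pot: "\<And>y. y \<in> E \<Longrightarrow> potential M y = ennreal V"
  shows "equilibrium_measure (affine_point ` E) (to_proj M)"
    "robin_const (affine_point ` E) = ennreal V"
proof -
  have "(\<integral>\<^sup>+ x. neg_log_dist x y \<partial>to_proj M) = ennreal V" if "y \<in> affine_point ` E" for y
    using that pot nn_integral_neg_log_dist_to_proj[OF borel_prob_onD(1)[OF M]] by auto
  then show "equilibrium_measure (affine_point ` E) (to_proj M)"
    "robin_const (affine_point ` E) = ennreal V"
    using equilibrium_if_potential_constant[OF compact_affine_image[OF E] borel_prob_on_to_proj[OF E M]]
    by blast+
qed

lemma equilibrium_frac_ideal_nonneg:
  fixes n :: int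
  assumes "n \<ge> 0"
  shows "equilibrium_measure (affine_point ` frac_ideal \<pi> n) (to_proj (add_haar \<pi> n))"
    "robin_const (affine_point ` frac_ideal \<pi> n) = ennreal (- of_int n * ln r - ln r / (real q - 1))"
proof -
  obtain N where n: "n = int N" using assms nonneg_int_cases by blast
  have M: "borel_prob_on (frac_ideal \<pi> n) (add_haar \<pi> n)"
    using homogeneous_add_haar unfolding homogeneous_measure_def by blast
  have "- ln r * (real N + 1 / (real q - 1)) = - of_int n * ln r - ln r / (real q - 1)"
    by (simp add: n algebra_simps)
  then have "potential (add_haar \<pi> n) y = ennreal (- of_int n * ln r - ln r / (real q - 1))"
    if "y \<in> frac_ideal \<pi> n" for y
    using potential_add_haar[of y N] that by (simp add: n)
  from equilibrium_to_proj[OF compact_frac_ideal M this]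
  show "equilibrium_measure (affine_point ` frac_ideal \<pi> n) (to_proj (add_haar \<pi> n))"
    "robin_const (affine_point ` frac_ideal \<pi> n) = ennreal (- of_int n * ln r - ln r / (real q - 1))"
    by blast+
qed

lemma equilibrium_frac_ideal_nonpos:
  assumes "n \<le> 0" and c: "\<And>k. k \<in> {n..0} \<Longrightarrow> c k \<ge> 0"
    and sys: "equilibrium_system (- ln r) q n c v"
  shows "equilibrium_measure (affine_point ` frac_ideal \<pi> n) (to_proj (lincomb_measure {n..0} c (component \<pi>)))"
    "robin_const (affine_point ` frac_ideal \<pi> n) = ennreal v"
proof -
  have sum1: "(\<Sum>k\<in>{n..0}. c k) = 1" using sys by (simp add: equilibrium_system_def)
  have M: "borel_prob_on (frac_ideal \<pi> n) (lincomb_measure {n..0} c (component \<pi>))"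
    using borel_prob_on_lincomb_measure[where P = piece, OF _ borel_prob_on_component c sum1
        frac_ideal_eq_Union_pieces[OF assms(1)] borel_compact[OF compact_frac_ideal]]
    by simp
  have "potential (lincomb_measure {n..0} c (component \<pi>)) y = ennreal v" if y: "y \<in> frac_ideal \<pi> n" for y
  proof -
    obtain i where i: "i \<in> {n..0}" "y \<in> piece i"
      using y unfolding frac_ideal_eq_Union_pieces[OF assms(1)] by blast
    \<comment> \<open>Nonnegative entries and coefficients let the \<open>ennreal\<close> potential
      be evaluated as a real row sum of the system.\<close>
    have entry: "0 \<le> energy_matrix (- ln r) q i j" if "j \<in> {n..0}" for j
    proof -
      define X where "X = real q / (real q - 1)\<^sup>2"
      have "0 \<le> X" "0 \<le> 1 / (real q - 1)" using q_ge_2 by (simp_all add: X_def)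
      then show ?thesis
        using i(1) that ln_r_neg unfolding energy_matrix_def X_def[symmetric]
        by (intro mult_nonneg_nonneg) auto
    qed
    have "potential (lincomb_measure {n..0} c (component \<pi>)) y =
        (\<Sum>j\<in>{n..0}. ennreal (c j) * potential (component \<pi> j) y)"
      by (rule potential_lincomb_measure) (simp_all add: borel_prob_onD(1)[OF borel_prob_on_component])
    also have "\<dots> = (\<Sum>j\<in>{n..0}. ennreal (energy_matrix (- ln r) q i j * c j))"
    proof (rule sum.cong[OF refl])
      fix j assume j: "j \<in> {n..0}"
      then show "ennreal (c j) * potential (component \<pi> j) y = ennreal (energy_matrix (- ln r) q i j * c j)"
        using potential_component[OF i(2), of j] i(1) entry[OF j] c[OF j]
        by (simp add: ennreal_mult mult.commute)
    qed
    also have "\<dots> = ennreal (\<Sum>j\<in>{n..0}. energy_matrix (- ln r) q i j * c j)"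
      using entry c by (intro sum_ennreal mult_nonneg_nonneg) auto
    also have "\<dots> = ennreal v" using sys i(1) by (simp add: equilibrium_system_def)
    finally show ?thesis .
  qed
  from equilibrium_to_proj[OF compact_frac_ideal M this]
  show "equilibrium_measure (affine_point ` frac_ideal \<pi> n) (to_proj (lincomb_measure {n..0} c (component \<pi>)))"
    "robin_const (affine_point ` frac_ideal \<pi> n) = ennreal v"
    by blast+
qed

end

theorem theorem10:
  fixes \<pi> :: "'a::nonarch_local_field" and q :: nat and n :: int
  assumes "uniformizer \<pi>" and "q = card (residue_classes \<pi>)"
  shows "(n \<ge> 0 \<longrightarrow>
      equilibrium_measure (affine_point ` frac_ideal \<pi> n) (to_proj (add_haar \<pi> n)) \<and>
      robin_const (affine_point ` frac_ideal \<pi> n) =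
        ennreal (- of_int n * ln (absval \<pi>) - ln (absval \<pi>) / (real q - 1))) \<and>
    (n < 0 \<longrightarrow>
      (\<exists>c v. (\<forall>k\<in>{n..0}. c k \<ge> 0) \<and> (\<Sum>k\<in>{n..0}. c k) = 1 \<and>
        equilibrium_system (- ln (absval \<pi>)) q n c v \<and>
        (\<forall>c' v'. equilibrium_system (- ln (absval \<pi>)) q n c' v' \<longrightarrow>
          v' = v \<and> (\<forall>k\<in>{n..0}. c' k = c k)) \<and>
        equilibrium_measure (affine_point ` frac_ideal \<pi> n)
          (to_proj (lincomb_measure {n..0} c (component \<pi>)))) \<and>
      robin_const (affine_point ` frac_ideal \<pi> n) =
        ennreal (- (real q + real q powi (2 * n)) / ((real q)\<^sup>2 - 1) * ln (absval \<pi>)))"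
proof -
  interpret uniformized_local_field \<pi> by unfold_locales (rule assms(1))
  have l: "- ln (absval \<pi>) > 0" using ln_r_neg by simp
  have q: "2 \<le> q" using card_residue_classes_ge_2 assms(2) by simp
  note nonneg = equilibrium_frac_ideal_nonneg[of n, folded assms(2)]
  have neg: "\<exists>c v. (\<forall>k\<in>{n..0}. c k \<ge> 0) \<and> (\<Sum>k\<in>{n..0}. c k) = 1 \<and>
        equilibrium_system (- ln (absval \<pi>)) q n c v \<and>
        (\<forall>c' v'. equilibrium_system (- ln (absval \<pi>)) q n c' v' \<longrightarrow>
          v' = v \<and> (\<forall>k\<in>{n..0}. c' k = c k)) \<and>
        equilibrium_measure (affine_point ` frac_ideal \<pi> n)
          (to_proj (lincomb_measure {n..0} c (component \<pi>)))"
    and robin: "robin_const (affine_point ` frac_ideal \<pi> n) =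
        ennreal (- (real q + real q powi (2 * n)) / ((real q)\<^sup>2 - 1) * ln (absval \<pi>))" if "n < 0"
  proof -
    obtain N where n: "n = - int N" using \<open>n < 0\<close> nonpos_int_cases[of n] by auto
    define c where "c k = coefficient q N (nat (- k))" for k
    define v where "v = - ln (absval \<pi>) * ((real q + (1 / q) ^ (2 * N)) / ((real q)\<^sup>2 - 1))"
    have c: "c k \<ge> 0" for k using q by (simp add: c_def coefficient_nonneg)
    have sys: "equilibrium_system (- ln (absval \<pi>)) q n c v"
      unfolding n c_def v_def using q by (rule equilibrium_system_coefficient)
    \<comment> \<open>Uniqueness makes the linear system determine the coefficients, rather than
      merely hold for them.\<close>
    have uniq: "v' = v \<and> (\<forall>k\<in>{n..0}. c' k = c k)"
      if "equilibrium_system (- ln (absval \<pi>)) q n c' v'" for c' v'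
      using equilibrium_system_unique[OF l q sys[unfolded n] that[unfolded n]] by (simp add: n)
    have sum1: "(\<Sum>k\<in>{n..0}. c k) = 1" using sys by (simp add: equilibrium_system_def)
    note eq = equilibrium_frac_ideal_nonpos[of n c v, folded assms(2), OF less_imp_le[OF \<open>n < 0\<close>] c sys]
    show "\<exists>c v. (\<forall>k\<in>{n..0}. c k \<ge> 0) \<and> (\<Sum>k\<in>{n..0}. c k) = 1 \<and>
        equilibrium_system (- ln (absval \<pi>)) q n c v \<and>
        (\<forall>c' v'. equilibrium_system (- ln (absval \<pi>)) q n c' v' \<longrightarrow>
          v' = v \<and> (\<forall>k\<in>{n..0}. c' k = c k)) \<and>
        equilibrium_measure (affine_point ` frac_ideal \<pi> n)
          (to_proj (lincomb_measure {n..0} c (component \<pi>)))"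
      by (intro exI[of _ c] exI[of _ v] conjI ballI allI impI c sum1 sys eq(1))
        (use uniq in blast)+
    have "real q powi (2 * n) = (1 / q) ^ (2 * N)"
      by (simp add: n power_int_def nat_mult_distrib inverse_eq_divide)
    then have "v = - (real q + real q powi (2 * n)) / ((real q)\<^sup>2 - 1) * ln (absval \<pi>)"
      by (simp only: v_def minus_divide_left[symmetric] mult_minus_left mult.commute)
    then show "robin_const (affine_point ` frac_ideal \<pi> n) =
        ennreal (- (real q + real q powi (2 * n)) / ((real q)\<^sup>2 - 1) * ln (absval \<pi>))"
      using eq(2) by simp
  qed
  show ?thesis using nonneg neg robin by blast
qed

end
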